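(* Let $n\geq 3$ and $m>2$ be integers, let $\{F_1,\ldots,F_{nm}\}$ be a collection of $nm$ distinct vertical fibres of $\mathbb{P}^1\times\mathbb{P}^1$ and let $\{G_1,\ldots,G_{nm}\}$ be a collection of $nm$ distinct horizontal fibres of $\mathbb{P}^1\times\mathbb{P}^1$. Let $X_n\to X_{n-1}\to\cdots\to X_1\to X_0=\mathbb{P}^1\times\mathbb{P}^1$ be the associated tower of $n$ cyclic covers of degree $m$ (defined in the context). Then $X_n$ is hyperbolic.
   Context: All varieties are over $\mathbb{C}$. Elements of $\mathrm{Pic}(\mathbb{P}^1\times\mathbb{P}^1)\simeq\mathbb{Z}^2$ are denoted $(a,b)$. Construction of the tower: $X_0=\mathbb{P}^1\times\mathbb{P}^1$, and for $0\le k\le n-1$ one has $F_{km+1}+\cdots+F_{(k+1)m}+G_{km+1}+\cdots+G_{(k+1)m}=(m,m)$ in $\mathrm{Pic}(X_0)$. Inductively, with $g_k\colon X_k\to X_0$ the composed map ($g_0=\mathrm{id}$), $f_{k+1}\colon X_{k+1}\to X_k$ is the degree-$m$ cyclic cover $X_{k+1}=\mathrm{Spec}_{X_k}\bigoplus_{j=0}^{m-1}g_k^*(1,1)^{-j}$, where the algebra structure is given by a section of $g_k^*(1,1)^{\otimes m}$ with zero divisor $g_k^*(F_{km+1}+\cdots+F_{(k+1)m}+G_{km+1}+\cdots+G_{(k+1)m})$ (an $m$-th root of the defining section is adjoined). The $X_k$ are normal projective surfaces whose only singularities are of type $A_{m-1}$, locally $(z^m-xy=0)\subset\mathbb{C}^3$.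 A surface $X$ is hyperbolic if it has no entire curves, i.e. every holomorphic map $\mathbb{C}\to X$ is constant. *)

theory Defs
  imports "HOL-Complex_Analysis.Complex_Analysis"
begin

section \<open>Complex varieties presented by affine charts\<close>

text \<open>
  A reduced complex variety is given by its points and an atlas of affine open subsets.  For
  each index \<open>i\<close>, the functions in \<open>coords V i\<close> generate the coordinate ring of \<open>chart V i\<close>, so
  they embed \<open>chart V i\<close> as a closed subset of an affine space.
\<close>

record ('i, 'a) cvariety =
  points :: "'a set"
  chart :: "'i \<Rightarrow> 'a set"
  coords :: "'i \<Rightarrow> ('a \<Rightarrow> complex) set"

inductive_set generated_algebra :: "('a \<Rightarrow> complex) set \<Rightarrow> ('a \<Rightarrow> complex) set"
  for C :: "('a \<Rightarrow> complex) set" where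
  const: "(\<lambda>_. a) \<in> generated_algebra C"
| gen: "c \<in> C \<Longrightarrow> c \<in> generated_algebra C"
| add: "f \<in> generated_algebra C \<Longrightarrow> g \<in> generated_algebra C \<Longrightarrow>
    (\<lambda>x. f x + g x) \<in> generated_algebra C"
| mult: "f \<in> generated_algebra C \<Longrightarrow> g \<in> generated_algebra C \<Longrightarrow>
    (\<lambda>x. f x * g x) \<in> generated_algebra C"

definition regular_on_chart :: "('i, 'a) cvariety \<Rightarrow> 'i \<Rightarrow> ('a \<Rightarrow> complex) \<Rightarrow> bool" where
  "regular_on_chart V i h \<longleftrightarrow>
     (\<exists>r \<in> generated_algebra (coords V i). \<forall>x \<in> chart V i. h x = r x)"

definition regular_unit :: "('i, 'a) cvariety \<Rightarrow> ('a \<Rightarrow> complex) \<Rightarrow> bool" where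
  "regular_unit V h \<longleftrightarrow> (\<forall>i. regular_on_chart V i h) \<and> (\<forall>x \<in> points V. h x \<noteq> 0)"

text \<open>
  Holomorphic maps from the complex plane to the analytic space underlying \<open>V\<close>.  As the analytic
  topology of a chart is induced by its coordinates, continuity is part of this condition.
\<close>

definition holomorphic_curve :: "('i, 'a) cvariety \<Rightarrow> (complex \<Rightarrow> 'a) \<Rightarrow> bool" where
  "holomorphic_curve V f \<longleftrightarrow>
     range f \<subseteq> points V \<and>
     (\<forall>i. open (f -` chart V i) \<and>
          (\<forall>c \<in> coords V i. (\<lambda>t. c (f t)) holomorphic_on (f -` chart V i)))"

definition hyperbolic :: "('i, 'a) cvariety \<Rightarrow> bool" where
  "hyperbolic V \<longleftrightarrow> (\<forall>f. holomorphic_curve V f \<longrightarrow> f constant_on UNIV)"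


section \<open>The surface $P^1 \times P^1$ and its line bundles\<close>

text \<open>The points of the projective line are the lines through the origin of the plane.\<close>

typedef p1 = "{vec.span {v} | v :: complex ^ 2. v \<noteq> 0}"
proof -
  have "(axis 1 1 :: complex ^ 2) \<noteq> 0"
    by (simp add: axis_eq_0_iff)
  then show ?thesis by blast
qed

definition reps :: "p1 \<Rightarrow> (complex ^ 2) set" where
  "reps p = Rep_p1 p - {0}"

text \<open>
  A choice of homogeneous coordinates.  It is only used in expressions that do not depend on it.
\<close>

definition hcoord :: "p1 \<Rightarrow> complex ^ 2" where
  "hcoord p = (SOME v. v \<in> reps p)"

text \<open>
  The line bundle \<open>(a,b)\<close> is the tensor product of the pulled-back powers of the duals of the
  tautological bundles.  Hence an element of its fibre over \<open>(p,q)\<close> is a function of bidegree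
  \<open>(a,b)\<close> on the pairs of nonzero vectors of the lines \<open>p\<close> and \<open>q\<close> (extended by zero), and tensor
  products of such elements are pointwise products.
\<close>

type_synonym bundle_elt = "complex ^ 2 \<Rightarrow> complex ^ 2 \<Rightarrow> complex"

definition bundle_fibre :: "nat \<Rightarrow> nat \<Rightarrow> p1 \<times> p1 \<Rightarrow> bundle_elt set" where
  "bundle_fibre a b P = {\<phi>.
     (\<forall>v \<in> reps (fst P). \<forall>w \<in> reps (snd P). \<forall>c d. c \<noteq> 0 \<longrightarrow> d \<noteq> 0 \<longrightarrow>
        \<phi> (c *s v) (d *s w) = c ^ a * d ^ b * \<phi> v w) \<and>
     (\<forall>v w. v \<notin> reps (fst P) \<or> w \<notin> reps (snd P) \<longrightarrow> \<phi> v w = 0)}"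

definition std_chart :: "2 \<times> 2 \<Rightarrow> (p1 \<times> p1) set" where
  "std_chart i = {P. hcoord (fst P) $ fst i \<noteq> 0 \<and> hcoord (snd P) $ snd i \<noteq> 0}"

text \<open>
  The coordinate of an element \<open>\<phi>\<close> of the fibre over \<open>P\<close> of the bundle \<open>(a,b)\<close> with respect to the
  frame $x_i^a y_j^b$ over the standard chart with index $(i,j)$.
\<close>

definition frame_coord :: "nat \<Rightarrow> nat \<Rightarrow> 2 \<times> 2 \<Rightarrow> p1 \<times> p1 \<Rightarrow> bundle_elt \<Rightarrow> complex" where
  "frame_coord a b i P \<phi> =
     \<phi> (hcoord (fst P)) (hcoord (snd P)) /
       ((hcoord (fst P) $ fst i) ^ a * (hcoord (snd P) $ snd i) ^ b)"

definition vertical_fibre :: "(p1 \<times> p1) set \<Rightarrow> bool" where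
  "vertical_fibre F \<longleftrightarrow> (\<exists>p. F = {p} \<times> UNIV)"

definition horizontal_fibre :: "(p1 \<times> p1) set \<Rightarrow> bool" where
  "horizontal_fibre G \<longleftrightarrow> (\<exists>q. G = UNIV \<times> {q})"

text \<open>
  Linear forms in one pair of homogeneous coordinates, i.e. global sections of \<open>(1,0)\<close> and \<open>(0,1)\<close>,
  that cut out a given fibre.  A nonzero linear form on the plane has a simple zero, so the zero
  divisor of the form is the fibre with multiplicity one.
\<close>

definition vertical_equation :: "(p1 \<times> p1) set \<Rightarrow> (complex ^ 2 \<Rightarrow> complex) \<Rightarrow> bool" where
  "vertical_equation F l \<longleftrightarrow>
     (\<exists>a b. \<forall>v. l v = a * v $ 1 + b * v $ 2) \<and> F = {P. \<forall>v \<in> reps (fst P). l v = 0}"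

definition horizontal_equation :: "(p1 \<times> p1) set \<Rightarrow> (complex ^ 2 \<Rightarrow> complex) \<Rightarrow> bool" where
  "horizontal_equation G l \<longleftrightarrow>
     (\<exists>a b. \<forall>w. l w = a * w $ 1 + b * w $ 2) \<and> G = {P. \<forall>w \<in> reps (snd P). l w = 0}"


section \<open>Cyclic covers and the tower\<close>

text \<open>
  A point of the \<open>k\<close>-th surface of the tower is a pair of a point \<open>P\<close> of $P^1 \times P^1$ and a list
  of \<open>k\<close> elements of the fibre over \<open>P\<close> of the bundle \<open>(1,1)\<close>.  The composed map to the bottom
  of the tower is \<open>fst\<close>, and the last covering map is \<open>cover_map\<close>.
\<close>

type_synonym tower_point = "(p1 \<times> p1) \<times> bundle_elt list"

type_synonym tower_variety = "(2 \<times> 2, tower_point) cvariety"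

definition cover_map :: "tower_point \<Rightarrow> tower_point" where
  "cover_map x = (fst x, butlast (snd x))"

definition P1xP1 :: tower_variety where
  "P1xP1 = \<lparr> points = {x. snd x = []},
     chart = (\<lambda>i. {x. snd x = [] \<and> fst x \<in> std_chart i}),
     coords = (\<lambda>i.
       range (\<lambda>a x. hcoord (fst (fst x)) $ a / hcoord (fst (fst x)) $ fst i) \<union>
       range (\<lambda>b x. hcoord (snd (fst x)) $ b / hcoord (snd (fst x)) $ snd i)) \<rparr>"

text \<open>Global sections of the pull-back to \<open>V\<close> of the bundle \<open>(a,b)\<close>.\<close>

definition pullback_section ::
    "tower_variety \<Rightarrow> nat \<Rightarrow> nat \<Rightarrow> (tower_point \<Rightarrow> bundle_elt) \<Rightarrow> bool" where
  "pullback_section V a b s \<longleftrightarrow>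
     (\<forall>x \<in> points V. s x \<in> bundle_fibre a b (fst x)) \<and>
     (\<forall>i. regular_on_chart V i (\<lambda>x. frame_coord a b i (fst x) (s x)))"

text \<open>
  The zero divisor of \<open>s\<close> is the pull-back of the sum of the fibres \<open>F i\<close> and \<open>G i\<close> with \<open>i \<in> I\<close>:
  two sections have the same (Cartier) zero divisor iff they differ by a global unit.
\<close>

definition zero_divisor_is_pullback ::
    "tower_variety \<Rightarrow> (tower_point \<Rightarrow> bundle_elt) \<Rightarrow>
     (nat \<Rightarrow> (p1 \<times> p1) set) \<Rightarrow> (nat \<Rightarrow> (p1 \<times> p1) set) \<Rightarrow> nat set \<Rightarrow> bool" where
  "zero_divisor_is_pullback V s F G I \<longleftrightarrow>
     (\<exists>l l' h. (\<forall>i \<in> I. vertical_equation (F i) (l i) \<and> horizontal_equation (G i) (l' i)) \<and>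
        regular_unit V h \<and>
        (\<forall>x \<in> points V. \<forall>v \<in> reps (fst (fst x)). \<forall>w \<in> reps (snd (fst x)).
           s x v w = h x * ((\<Prod>i\<in>I. l i v) * (\<Prod>i\<in>I. l' i w))))"

text \<open>
  The relative spectrum of the direct sum, for \<open>0 \<le> j < m\<close>, of the pull-backs of \<open>(-j,-j)\<close>, with
  multiplication given by the section \<open>s\<close> of the pull-back of \<open>(m,m)\<close>.  If \<open>A\<close> is the coordinate
  ring of a chart and \<open>s\<^sub>0\<close> is the coordinate of \<open>s\<close> there, this is $A[z]/(z^m - s_0)$; so the
  new point is an \<open>m\<close>-th root \<open>\<zeta>\<close> of \<open>s\<close> in the fibre of \<open>(1,1)\<close>, and \<open>z\<close> is the coordinate of \<open>\<zeta>\<close>.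
\<close>

definition cyclic_cover ::
    "nat \<Rightarrow> (tower_point \<Rightarrow> bundle_elt) \<Rightarrow> tower_variety \<Rightarrow> tower_variety" where
  "cyclic_cover m s V =
     (let Y = {(P, \<zeta>s @ [\<zeta>]) | P \<zeta>s \<zeta>.
                 (P, \<zeta>s) \<in> points V \<and> \<zeta> \<in> bundle_fibre 1 1 P \<and>
                 (\<forall>v \<in> reps (fst P). \<forall>w \<in> reps (snd P). \<zeta> v w ^ m = s (P, \<zeta>s) v w)}
      in \<lparr> points = Y,
           chart = (\<lambda>i. {x \<in> Y. cover_map x \<in> chart V i}),
           coords = (\<lambda>i. insert (\<lambda>x. frame_coord 1 1 i (fst x) (last (snd x)))
                       ((\<lambda>c. c \<circ> cover_map) ` coords V i)) \<rparr>)"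

text \<open>The section \<open>s k\<close> lives on the \<open>k\<close>-th surface and defines the next one.\<close>

primrec tower :: "nat \<Rightarrow> (nat \<Rightarrow> tower_point \<Rightarrow> bundle_elt) \<Rightarrow> nat \<Rightarrow> tower_variety" where
  "tower m s 0 = P1xP1"
| "tower m s (Suc k) = cyclic_cover m (s k) (tower m s k)"

end

(*
An entire curve in X_n projects to a pair of entire curves in the projective line, with entire
homogeneous lifts P and Q.  The m-th roots adjoined in the tower show that the product H of all
linear forms L_i(P) and M_j(Q) is, up to a nowhere vanishing factor, the m-th power of an entire
function.  Choose 0 < theta < 1 with nm * theta > 2 and m (1 - theta) > 2; theta = 1/4 works.  By the
first inequality the projective line carries a conformal metric of curvature at most a negative
constant with cone singularities |x|^(-theta) |dx| at the nm given points.  Let G be the geometric mean of its pullbacks under P and Q.  Away from the zeros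
of H, log G inherits the curvature estimate; at a zero of H of order e (so e >= m) the Wronskians
vanish to total order at least e - 2, so G is of order at least e (1 - theta) - 2 > 0 there.  The
Ahlfors-Schwarz argument on discs of growing radius gives G = 0, i.e. P or Q is constant as a
curve in the projective line.  The remaining curve is excluded by the same argument applied to a
pair of equal curves, after dropping the one level of the tower whose fibres may contain the image.
*)

theory Submission
  imports Defs "HOL-Library.Landau_Symbols"
begin

no_notation fps_nth (infixl "$" 75)

section \<open>Second-order expansions and the Laplacian\<close>

text \<open>The obstacle is that the roots control only the total order of the product H. Where both
  curves meet given fibres, the two orders add up to a multiple of m, but one of them may well be 1,
  and the cone metric pulled back by that curve alone may be unbounded there. A geometric mean sees
  only the sum of the orders; each of the two Wronskians loses one, whence the 2 in m (1 - theta) >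
  2. The two inequalities leave the window 2/(nm) < theta < 1 - 2/m. For n = m = 3 it is 2/9 < theta
  < 1/3, which suggests 1/4; for n = 2, m = 3 it would be empty.

  The Ahlfors-Schwarz argument uses the Laplacian only at a single maximum, so a pointwise
  second-order expansion can replace C^2 regularity. Its term \<open>d * h^2\<close> is the
  trace-free part of the Hessian; it has no influence on the Laplacian and is left existential.
  Working with homogeneous lifts makes all metrics explicit: off the zeros their logarithms are sums
  of harmonic functions \<open>ln |f|^2\<close>, of \<open>ln N\<close> for the norm
  \<open>N\<close> of the lift, and of one correction term.\<close>

text \<open>
  \<open>L\<close> is the Laplacian of \<open>u\<close> at \<open>t\<close> and \<open>c\<close> is twice its complex derivative
  \<open>\<partial>u/\<partial>z\<close>.
\<close>

definition second_order_at :: "(complex \<Rightarrow> real) \<Rightarrow> complex \<Rightarrow> complex \<Rightarrow> real \<Rightarrow> bool" where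
  "second_order_at u t c L \<longleftrightarrow>
     (\<exists>d. (\<lambda>h. u (t + h) - u t - Re (c * h + d * h^2) - L / 4 * (cmod h)^2) \<in> o[at 0](\<lambda>h. (cmod h)^2))"

lemma second_order_at_const [intro]: "second_order_at (\<lambda>_. a) t 0 0"
  unfolding second_order_at_def by (intro exI[of _ 0]) simp

lemma second_order_at_add [intro]:
  assumes "second_order_at u t c L" "second_order_at v t c' L'"
  shows "second_order_at (\<lambda>z. u z + v z) t (c + c') (L + L')"
proof -
  obtain d where d: "(\<lambda>h. u (t + h) - u t - Re (c * h + d * h^2) - L / 4 * (cmod h)^2) \<in> o[at 0](\<lambda>h. (cmod h)^2)"
    using assms(1) unfolding second_order_at_def by blast
  obtain d' where d': "(\<lambda>h. v (t + h) - v t - Re (c' * h + d' * h^2) - L' / 4 * (cmod h)^2) \<in> o[at 0](\<lambda>h. (cmod h)^2)"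
    using assms(2) unfolding second_order_at_def by blast
  show ?thesis
    unfolding second_order_at_def
  proof (intro exI[of _ "d + d'"])
    show "(\<lambda>h. u (t + h) + v (t + h) - (u t + v t) - Re ((c + c') * h + (d + d') * h^2) - (L + L') / 4 * (cmod h)^2)
        \<in> o[at 0](\<lambda>h. (cmod h)^2)"
      using sum_in_smallo(1)[OF d d'] by (simp add: algebra_simps add_divide_distrib)
  qed
qed

lemma second_order_at_cmult [intro]:
  assumes "second_order_at u t c L"
  shows "second_order_at (\<lambda>z. a * u z) t (of_real a * c) (a * L)"
proof -
  obtain d where d: "(\<lambda>h. u (t + h) - u t - Re (c * h + d * h^2) - L / 4 * (cmod h)^2) \<in> o[at 0](\<lambda>h. (cmod h)^2)"
    using assms(1) unfolding second_order_at_def by blast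
  have "(\<lambda>h. a * (u (t + h) - u t - Re (c * h + d * h^2) - L / 4 * (cmod h)^2)) \<in> o[at 0](\<lambda>h. (cmod h)^2)"
    using d by (cases "a = 0") simp_all
  then show ?thesis
    unfolding second_order_at_def
    by (intro exI[of _ "of_real a * d"]) (simp add: algebra_simps)
qed

lemma second_order_at_diff [intro]:
  assumes "second_order_at u t c L" "second_order_at v t c' L'"
  shows "second_order_at (\<lambda>z. u z - v z) t (c - c') (L - L')"
  using second_order_at_add[OF assms(1) second_order_at_cmult[OF assms(2), of "-1"]] by simp

lemma second_order_at_sum [intro]:
  assumes "\<And>i. i \<in> I \<Longrightarrow> second_order_at (u i) t (c i) (L i)"
  shows "second_order_at (\<lambda>z. \<Sum>i\<in>I. u i z) t (\<Sum>i\<in>I. c i) (\<Sum>i\<in>I. L i)"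
  using assms by (induction I rule: infinite_finite_induct) auto

text \<open>Adding the expansions in the four directions x, -x, ix, -ix cancels the linear terms in
  pairs, and the terms in \<open>h^2\<close> because (ix)^2 = -x^2. Only the Laplacian
  survives.\<close>

lemma second_order_at_local_max:
  assumes "second_order_at u t c L" and max: "\<forall>\<^sub>F z in at t. u z \<le> u t"
  shows "L \<le> 0"
proof (rule ccontr)
  assume "\<not> L \<le> 0"
  obtain d where d: "(\<lambda>h. u (t + h) - u t - Re (c * h + d * h^2) - L / 4 * (cmod h)^2) \<in> o[at 0](\<lambda>h. (cmod h)^2)"
    using assms(1) unfolding second_order_at_def by blast
  have "\<forall>\<^sub>F h in at 0. norm (u (t + h) - u t - Re (c * h + d * h^2) - L / 4 * (cmod h)^2) \<le> L / 8 * norm ((cmod h)^2)"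
    using landau_o.smallD[OF d, of "L/8"] \<open>\<not> L \<le> 0\<close> by simp
  moreover have "\<forall>\<^sub>F h in at 0. u (t + h) \<le> u t"
    using max by (simp add: at_to_0[of t] eventually_filtermap add.commute)
  ultimately have "\<forall>\<^sub>F h in at 0. Re (c * h + d * h^2) + L / 8 * (cmod h)^2 \<le> 0"
  proof eventually_elim
    case (elim h)
    have "\<bar>u (t + h) - u t - Re (c * h + d * h^2) - L / 4 * (cmod h)^2\<bar> \<le> L / 8 * (cmod h)^2"
      using elim(1) by simp
    then show ?case using elim(2) by (simp only: abs_le_iff) linarith
  qed
  then obtain r where r: "r > 0" "\<And>h. h \<noteq> 0 \<Longrightarrow> cmod h < r \<Longrightarrow> Re (c * h + d * h^2) + L / 8 * (cmod h)^2 \<le> 0"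
    by (auto simp: eventually_at dist_norm)
  define x where "x = r / 2"
  have x: "x > 0" "x < r" using r(1) by (auto simp: x_def)
  have "Re (c * of_real x + d * (of_real x)^2) + L / 8 * x^2 \<le> 0"
    using r(2)[of "of_real x"] x by simp
  moreover have "Re (c * (- of_real x) + d * (of_real x)^2) + L / 8 * x^2 \<le> 0"
    using r(2)[of "- of_real x"] x by simp
  moreover have "Re (c * (\<i> * of_real x) - d * (of_real x)^2) + L / 8 * x^2 \<le> 0"
    using r(2)[of "\<i> * of_real x"] x by (simp add: norm_mult power_mult_distrib)
  moreover have "Re (c * (- (\<i> * of_real x)) - d * (of_real x)^2) + L / 8 * x^2 \<le> 0"
    using r(2)[of "- (\<i> * of_real x)"] x by (simp add: norm_mult power_mult_distrib)
  ultimately have "4 * (L / 8 * x^2) \<le> 0" by simp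
  moreover have "L * x^2 > 0" using \<open>\<not> L \<le> 0\<close> x by simp
  ultimately show False by simp
qed

text \<open>Taylor's formula with Peano remainder: the derivative of the remainder is o(k), and the
  mean value inequality integrates this. The filter is \<open>nhds 0\<close> rather than
  \<open>at 0\<close> because the formula is later composed with an increment of \<open>u\<close>
  that may vanish for nonzero \<open>h\<close>.\<close>

lemma real_second_order:
  fixes f g :: "real \<Rightarrow> real"
  assumes "\<forall>\<^sub>F x in nhds a. (f has_real_derivative g x) (at x)" and "(g has_real_derivative D) (at a)"
  shows "(\<lambda>k. f (a + k) - f a - g a * k - D / 2 * k^2) \<in> o[nhds 0](\<lambda>k. k^2)"
proof (rule landau_o.smallI)
  fix e :: real assume e: "e > 0"
  obtain r where r: "r > 0" "\<And>x. \<bar>x - a\<bar> < r \<Longrightarrow> (f has_real_derivative g x) (at x)"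
    using assms(1) unfolding eventually_nhds_metric dist_real_def by blast
  have "\<forall>\<^sub>F x in at a. dist ((g x - g a) / (x - a)) D < e"
    using assms(2) unfolding has_field_derivative_iff tendsto_iff using e by blast
  then obtain s where s: "s > 0" "\<And>x. x \<noteq> a \<Longrightarrow> \<bar>x - a\<bar> < s \<Longrightarrow> \<bar>(g x - g a) / (x - a) - D\<bar> < e"
    unfolding eventually_at dist_real_def by blast
  have key: "\<bar>f (a + k) - f a - g a * k - D / 2 * k^2\<bar> \<le> e * k^2" if k: "\<bar>k\<bar> < min r s" for k
  proof -
    define R where "R = (\<lambda>k. f (a + k) - f a - g a * k - D / 2 * k^2)"
    have dR: "(R has_real_derivative (g (a + x) - g a - D * x)) (at x)" if "\<bar>x\<bar> < r" for x
    proof -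
      have "(f has_real_derivative g (a + x)) (at (a + x))" using r(2)[of "a + x"] that by simp
      then have "((\<lambda>k. f (a + k)) has_real_derivative g (a + x)) (at x)"
        using DERIV_shift[of f "g (a + x)" x a] by (simp add: add.commute)
      then show ?thesis unfolding R_def
        by (auto intro!: derivative_eq_intros)
    qed
    have bd: "\<bar>g (a + x) - g a - D * x\<bar> \<le> e * \<bar>k\<bar>" if "\<bar>x\<bar> \<le> \<bar>k\<bar>" for x
    proof (cases "x = 0")
      case False
      have "\<bar>(g (a + x) - g a) / x - D\<bar> < e" using s(2)[of "a + x"] False that k by simp
      then have "\<bar>((g (a + x) - g a) / x - D) * x\<bar> \<le> e * \<bar>x\<bar>" by (simp add: abs_mult mult_right_mono)
      moreover have "((g (a + x) - g a) / x - D) * x = g (a + x) - g a - D * x" using False by (simp add: field_simps)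
      moreover have "e * \<bar>x\<bar> \<le> e * \<bar>k\<bar>" using e that by simp
      ultimately show ?thesis by linarith
    qed (use e in simp)
    have "norm (R k - R 0) \<le> e * \<bar>k\<bar> * norm (k - 0)"
    proof (rule field_differentiable_bound[of "{-\<bar>k\<bar>..\<bar>k\<bar>}" R "\<lambda>x. g (a + x) - g a - D * x"])
      fix x assume "x \<in> {-\<bar>k\<bar>..\<bar>k\<bar>}"
      then have x: "\<bar>x\<bar> \<le> \<bar>k\<bar>" by auto
      show "(R has_real_derivative (g (a + x) - g a - D * x)) (at x within {-\<bar>k\<bar>..\<bar>k\<bar>})"
        using dR[of x] x k by (simp add: has_field_derivative_at_within)
      show "norm (g (a + x) - g a - D * x) \<le> e * \<bar>k\<bar>" using bd[OF x] by simp
    qed auto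
    then show ?thesis by (simp add: R_def power2_eq_square abs_mult mult.assoc)
  qed
  show "\<forall>\<^sub>F x in nhds 0. norm (f (a + x) - f a - g a * x - D / 2 * x\<^sup>2) \<le> e * norm (x\<^sup>2)"
    unfolding eventually_nhds_metric
    by (rule exI[of _ "min r s"]) (use key r s in \<open>auto simp: dist_real_def\<close>)
qed

text \<open>Since \<open>cmod c\<close> is the length of the gradient of \<open>u\<close>, this is
  the chain rule: the Laplacian of f(u) is f'(u) times that of u, plus f''(u) |grad u|^2.\<close>

lemma second_order_at_compose:
  assumes u: "second_order_at u t c L"
    and f: "\<forall>\<^sub>F x in nhds (u t). (f has_real_derivative g x) (at x)" "(g has_real_derivative D) (at (u t))"
  shows "second_order_at (\<lambda>z. f (u z)) t (of_real (g (u t)) * c) (g (u t) * L + D * (cmod c)^2)"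
proof -
  obtain d where d: "(\<lambda>h. u (t + h) - u t - Re (c * h + d * h^2) - L / 4 * (cmod h)^2) \<in> o[at 0](\<lambda>h. (cmod h)^2)"
    using u unfolding second_order_at_def by blast
  define E where "E = (\<lambda>h. u (t + h) - u t - Re (c * h + d * h^2) - L / 4 * (cmod h)^2)"
  define k where "k = (\<lambda>h. u (t + h) - u t)"
  have E: "E \<in> o[at 0](\<lambda>h. (cmod h)^2)" using d by (simp add: E_def)
  have small: "(\<lambda>h. (cmod h)^2) \<in> o[at 0](\<lambda>h. cmod h)"
  proof (rule landau_o.smallI)
    fix e :: real assume "e > 0"
    then show "\<forall>\<^sub>F h :: complex in at 0. norm ((cmod h)^2) \<le> e * norm (cmod h)"
      unfolding eventually_at by (intro exI[of _ e]) (auto simp: power2_eq_square intro!: mult_right_mono)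
  qed
  have bigsq: "(\<lambda>h. Re (d * h^2) + L / 4 * (cmod h)^2) \<in> O[at 0](\<lambda>h. (cmod h)^2)"
  proof (rule bigoI[of _ "cmod d + \<bar>L / 4\<bar>"], intro always_eventually allI)
    fix h
    have "\<bar>Re (d * h^2)\<bar> \<le> cmod d * (cmod h)^2"
      by (metis abs_Re_le_cmod norm_mult norm_power)
    moreover have "\<bar>L / 4 * (cmod h)^2\<bar> = \<bar>L / 4\<bar> * (cmod h)^2"
      by (simp only: abs_mult abs_power2)
    ultimately have "\<bar>Re (d * h^2) + L / 4 * (cmod h)^2\<bar> \<le> cmod d * (cmod h)^2 + \<bar>L / 4\<bar> * (cmod h)^2"
      by linarith
    then show "norm (Re (d * h^2) + L / 4 * (cmod h)^2) \<le> (cmod d + \<bar>L / 4\<bar>) * norm ((cmod h)^2)"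
      by (simp only: distrib_right real_norm_def abs_power2)
  qed
  have k1: "(\<lambda>h. k h - Re (c * h)) \<in> o[at 0](\<lambda>h. cmod h)"
  proof -
    have "(\<lambda>h. E h + (Re (d * h^2) + L / 4 * (cmod h)^2)) \<in> O[at 0](\<lambda>h. (cmod h)^2)"
      by (intro sum_in_bigo landau_o.small_imp_big[OF E] bigsq)
    then have "(\<lambda>h. E h + (Re (d * h^2) + L / 4 * (cmod h)^2)) \<in> o[at 0](\<lambda>h. cmod h)"
      using small by (rule landau_o.big_small_trans)
    then show ?thesis by (simp add: E_def k_def algebra_simps)
  qed
  have lin: "(\<lambda>h. Re (c * h)) \<in> O[at 0](\<lambda>h. cmod h)"
  proof (rule bigoI[of _ "cmod c"], intro always_eventually allI)
    show "norm (Re (c * h)) \<le> cmod c * norm (cmod h)" for h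
      using abs_Re_le_cmod[of "c * h"] by (simp only: norm_mult real_norm_def abs_norm_cancel)
  qed
  have kO: "k \<in> O[at 0](\<lambda>h. cmod h)"
    using sum_in_bigo(1)[OF landau_o.small_imp_big[OF k1] lin] by simp
  have ksq: "(\<lambda>h. (k h)^2 - (Re (c * h))^2) \<in> o[at 0](\<lambda>h. (cmod h)^2)"
  proof -
    have "(\<lambda>h. (k h - Re (c * h)) * (k h + Re (c * h))) \<in> o[at 0](\<lambda>h. cmod h * cmod h)"
      by (intro landau_o.small_big_mult k1 sum_in_bigo kO lin)
    then show ?thesis by (simp add: power2_eq_square algebra_simps)
  qed
  have klim: "filterlim k (nhds 0) (at 0)"
  proof -
    obtain C where C: "\<forall>\<^sub>F h in at 0. norm (k h) \<le> C * norm (cmod h)"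
      using kO by (elim landau_o.bigE)
    have "((\<lambda>h :: complex. cmod h) \<longlongrightarrow> 0) (at 0)" by (intro tendsto_eq_intros) auto
    then show ?thesis
      by (rule tendsto_0_le[where K = C]) (use C in \<open>simp add: mult.commute\<close>)
  qed
  have "(\<lambda>x. f (u t + x) - f (u t) - g (u t) * x - D / 2 * x^2) \<in> o[nhds 0](\<lambda>x. x^2)"
    by (rule real_second_order[OF f])
  then have "(\<lambda>h. f (u t + k h) - f (u t) - g (u t) * k h - D / 2 * (k h)^2) \<in> o[at 0](\<lambda>h. (k h)^2)"
    using klim by (rule landau_o.small.compose)
  also have "(\<lambda>h. (k h)^2) \<in> O[at 0](\<lambda>h. (cmod h)^2)"
    using landau_o.big_power[OF kO, of 2] by simp
  finally have R: "(\<lambda>h. f (u t + k h) - f (u t) - g (u t) * k h - D / 2 * (k h)^2) \<in> o[at 0](\<lambda>h. (cmod h)^2)" .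
  \<comment> \<open>Splits the square of the linear term into a trace-free part, which is absorbed
    by \<open>d'\<close>, and a multiple of \<open>(cmod z)^2\<close>, which is the gradient term of
    the Laplacian.\<close>
  have sq: "(Re z)^2 = Re (z^2) / 2 + (cmod z)^2 / 2" for z
  proof -
    have "Re (z^2) = (Re z)^2 - (Im z)^2" by (simp add: power2_eq_square)
    then show ?thesis using cmod_power2[of z] by (simp add: field_simps)
  qed
  define d' where "d' = of_real (g (u t)) * d + of_real (D / 4) * c^2"
  have "(\<lambda>h. g (u t) * E h) \<in> o[at 0](\<lambda>h. (cmod h)^2)" using E by (cases "g (u t) = 0") simp_all
  moreover have "(\<lambda>h. D / 2 * ((k h)^2 - (Re (c * h))^2)) \<in> o[at 0](\<lambda>h. (cmod h)^2)" using ksq by (cases "D = 0") simp_all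
  ultimately have S: "(\<lambda>h. (f (u t + k h) - f (u t) - g (u t) * k h - D / 2 * (k h)^2) +
      (g (u t) * E h + D / 2 * ((k h)^2 - (Re (c * h))^2))) \<in> o[at 0](\<lambda>h. (cmod h)^2)"
    by (intro sum_in_smallo R)
  have eq: "(f (u t + k h) - f (u t) - g (u t) * k h - D / 2 * (k h)^2) +
      (g (u t) * E h + D / 2 * ((k h)^2 - (Re (c * h))^2)) =
      f (u (t + h)) - f (u t) - Re (of_real (g (u t)) * c * h + d' * h^2) -
      (g (u t) * L + D * (cmod c)^2) / 4 * (cmod h)^2" for h
  proof -
    have 1: "Re (of_real (g (u t)) * c * h + d' * h^2) =
        g (u t) * Re (c * h) + g (u t) * Re (d * h^2) + D / 4 * Re (c^2 * h^2)"
    proof -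
      have "of_real (g (u t)) * c * h + d' * h^2 =
        of_real (g (u t)) * (c * h) + of_real (g (u t)) * (d * h^2) + of_real (D / 4) * (c^2 * h^2)"
        by (simp add: d'_def algebra_simps)
      then show ?thesis by (simp only: plus_complex.simps Re_complex_of_real Im_complex_of_real times_complex.simps)
    qed
    have 2: "(Re (c * h))^2 = Re (c^2 * h^2) / 2 + (cmod c)^2 * (cmod h)^2 / 2"
      using sq[of "c * h"] by (simp only: power_mult_distrib norm_mult)
    have 3: "u t + k h = u (t + h)" by (simp add: k_def)
    have 4: "E h = k h - Re (c * h) - Re (d * h^2) - L / 4 * (cmod h)^2" by (simp add: E_def k_def)
    have alg: "(A - B - p * x - D / 2 * x^2) + (p * (x - y - q - L / 4 * n) + D / 2 * (x^2 - (r / 2 + m * n / 2)))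
       = A - B - (p * y + p * q + D / 4 * r) - (p * L + D * m) / 4 * n" for A B p x y q n r m :: real
      by (simp add: algebra_simps add_divide_distrib)
    show ?thesis unfolding 1 2 3 4 by (rule alg)
  qed
  show ?thesis
    unfolding second_order_at_def by (intro exI[of _ d']) (rule S[unfolded eq])
qed

lemma second_order_at_ln:
  assumes "second_order_at u t c L" "u t > 0"
  shows "second_order_at (\<lambda>z. ln (u z)) t (c / of_real (u t)) (L / u t - (cmod c)^2 / (u t)^2)"
proof -
  have 1: "\<forall>\<^sub>F x in nhds (u t). (ln has_real_derivative inverse x) (at x)"
  proof -
    have "\<forall>\<^sub>F x in nhds (u t). x \<in> {0<..}"
      using assms(2) by (intro eventually_nhds_in_open) auto
    then show ?thesis
      by eventually_elim (rule DERIV_ln, simp)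
  qed
  have 2: "(inverse has_real_derivative (- ((inverse (u t))^2))) (at (u t))"
    using DERIV_inverse[of "u t" UNIV] assms(2) by (simp add: numeral_2_eq_2)
  show ?thesis
    using second_order_at_compose[OF assms(1) 1 2] by (simp add: field_simps)
qed

lemma second_order_at_exp:
  assumes "second_order_at u t c L"
  shows "second_order_at (\<lambda>z. exp (u z)) t (of_real (exp (u t)) * c) (exp (u t) * (L + (cmod c)^2))"
proof -
  have "\<forall>\<^sub>F x in nhds (u t). (exp has_real_derivative exp x) (at x)" "(exp has_real_derivative exp (u t)) (at (u t))"
    by (simp_all add: DERIV_exp)
  from second_order_at_compose[OF assms this] show ?thesis by (simp add: algebra_simps)
qed

text \<open>Dividing twice by \<open>z - t\<close>, with removable singularities, gives f(t + h) =
  f(t) + a h + h^2 G(t + h). In the squared modulus the product of f(t) with the last term is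
  trace-free up to o(|h|^2), so |a h|^2 alone determines the Laplacian.\<close>

lemma second_order_at_norm_square:
  assumes f: "f holomorphic_on S" "open S" "t \<in> S"
  shows "second_order_at (\<lambda>z. (cmod (f z))^2) t (2 * cnj (f t) * deriv f t) (4 * (cmod (deriv f t))^2)"
proof -
  define a where "a = deriv f t"
  define F where "F = (\<lambda>z. if z = t then deriv f t else (f z - f t) / (z - t))"
  define G where "G = (\<lambda>z. if z = t then deriv F t else (F z - F t) / (z - t))"
  have F: "F holomorphic_on S" unfolding F_def by (rule pole_lemma_open[OF f(1,2)])
  have G: "G holomorphic_on S" unfolding G_def by (rule pole_lemma_open[OF F f(2)])
  have fG: "f (t + h) = f t + a * h + h^2 * G (t + h)" for h
    by (cases "h = 0") (simp_all add: F_def G_def a_def power2_eq_square divide_simps)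
  have "G \<midarrow>t\<rightarrow> G t"
    using holomorphic_on_imp_continuous_on[OF G] f by (simp add: continuous_on_eq_continuous_at isCont_def)
  then have Gt: "((\<lambda>h. G (t + h)) \<longlongrightarrow> G t) (at 0)" by (simp add: LIM_offset_zero)
  define E where "E = (\<lambda>h. 2 * Re (cnj (f t) * h^2 * (G (t + h) - G t)) + 2 * Re (cnj (a * h) * h^2 * G (t + h)) + (cmod (h^2 * G (t + h)))^2)"
  have "((\<lambda>h. E h / (cmod h)^2) \<longlongrightarrow> 0) (at 0)"
  proof (rule tendsto_0_le[where K = 1])
    show "((\<lambda>h. 2 * cmod (f t) * cmod (G (t + h) - G t) + 2 * cmod a * cmod h * cmod (G (t + h)) + (cmod h)^2 * (cmod (G (t + h)))^2) \<longlongrightarrow> 0) (at 0)"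
      by (rule tendsto_eq_intros Gt refl | simp)+
    have "norm (E h / (cmod h)^2) \<le> 2 * cmod (f t) * cmod (G (t + h) - G t) + 2 * cmod a * cmod h * cmod (G (t + h)) + (cmod h)^2 * (cmod (G (t + h)))^2"
      if "h \<noteq> 0" for h
    proof -
      have "\<bar>E h\<bar> \<le> 2 * cmod (cnj (f t) * h^2 * (G (t + h) - G t)) + 2 * cmod (cnj (a * h) * h^2 * G (t + h)) + (cmod (h^2 * G (t + h)))^2"
        using abs_Re_le_cmod[of "cnj (f t) * h^2 * (G (t + h) - G t)"] abs_Re_le_cmod[of "cnj (a * h) * h^2 * G (t + h)"]
          zero_le_power2[of "cmod (h^2 * G (t + h))"]
        unfolding E_def by linarith
      also have "\<dots> = (2 * cmod (f t) * cmod (G (t + h) - G t) + 2 * cmod a * cmod h * cmod (G (t + h)) + (cmod h)^2 * (cmod (G (t + h)))^2) * (cmod h)^2"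
        by (simp only: norm_mult norm_power complex_mod_cnj) (simp add: power2_eq_square distrib_left distrib_right mult.assoc mult.left_commute mult.commute)
      finally show ?thesis using that by (simp add: pos_divide_le_eq)
    qed
    then show "\<forall>\<^sub>F h in at 0. norm (E h / (cmod h)^2) \<le> norm (2 * cmod (f t) * cmod (G (t + h) - G t) + 2 * cmod a * cmod h * cmod (G (t + h)) + (cmod h)^2 * (cmod (G (t + h)))^2) * 1"
      unfolding eventually_at by (intro exI[of _ 1]) (auto intro: order.trans[OF _ abs_ge_self])
  qed
  then have "E \<in> o[at 0](\<lambda>h. (cmod h)^2)"
    by (rule smalloI_tendsto) (simp add: eventually_at_filter)
  moreover have "(cmod (f (t + h)))^2 - (cmod (f t))^2 - Re (2 * cnj (f t) * a * h + 2 * cnj (f t) * G t * h^2) - 4 * (cmod a)^2 / 4 * (cmod h)^2 = E h" for h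
  proof -
    have sq3: "(cmod (x + y + w))^2 = (cmod x)^2 + 2 * Re (cnj x * y) + 2 * Re (cnj x * w) + (cmod y)^2 + 2 * Re (cnj y * w) + (cmod w)^2" for x y w
    proof -
      have sq2: "(cmod (x + y))^2 = (cmod x)^2 + 2 * Re (cnj x * y) + (cmod y)^2" for x y
        by (simp add: cmod_power2) (simp add: power2_eq_square algebra_simps)
      show ?thesis unfolding sq2 by (simp add: distrib_right)
    qed
    have 1: "2 * Re (cnj (f t) * (a * h)) = Re (2 * cnj (f t) * a * h)"
      by (simp add: mult.assoc)
    have 2: "2 * Re (cnj (f t) * (h^2 * G (t + h))) = 2 * Re (cnj (f t) * h^2 * (G (t + h) - G t)) + Re (2 * cnj (f t) * G t * h^2)"
      by (simp add: algebra_simps)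
    have 3: "cnj (a * h) * (h^2 * G (t + h)) = cnj (a * h) * h^2 * G (t + h)" by (simp add: mult.assoc)
    have 4: "(cmod (a * h))^2 = (cmod a)^2 * (cmod h)^2" by (simp add: norm_mult power_mult_distrib)
    show ?thesis unfolding fG[of h] sq3 1 2 3 4 E_def plus_complex.simps by linarith
  qed
  ultimately show ?thesis
    unfolding second_order_at_def a_def[symmetric]
    by (intro exI[of _ "2 * cnj (f t) * G t"]) (simp only:)
qed

lemma second_order_at_cong:
  assumes "second_order_at u t c L" and ev: "\<forall>\<^sub>F z in nhds t. u z = v z"
  shows "second_order_at v t c L"
proof -
  obtain d where d: "(\<lambda>h. u (t + h) - u t - Re (c * h + d * h^2) - L / 4 * (cmod h)^2) \<in> o[at 0](\<lambda>h. (cmod h)^2)"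
    using assms(1) unfolding second_order_at_def by blast
  have "u t = v t" using ev by (rule eventually_nhds_x_imp_x)
  have "\<forall>\<^sub>F z in at t. u z = v z" using ev by (simp add: eventually_at_filter eventually_mono)
  then have "\<forall>\<^sub>F h in at 0. u (t + h) = v (t + h)"
    by (simp add: at_to_0[of t] eventually_filtermap add.commute)
  then have "\<forall>\<^sub>F h in at 0. v (t + h) - v t - Re (c * h + d * h^2) - L / 4 * (cmod h)^2
      = u (t + h) - u t - Re (c * h + d * h^2) - L / 4 * (cmod h)^2"
    by eventually_elim (simp add: \<open>u t = v t\<close>)
  from landau_o.small.in_cong[OF this] d show ?thesis
    unfolding second_order_at_def by blast
qed

section \<open>The Ahlfors-Schwarz argument\<close>

text \<open>Compares \<open>G\<close> with the Poincare metric of the disc of radius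
  \<open>R\<close> about \<open>s\<close>, a multiple of \<open>1 / v^2\<close>. As \<open>v\<close>
  vanishes on the boundary circle, \<open>G * v^2\<close> has an interior maximum, and there the
  Laplacian of \<open>ln G\<close> is at most 8 R^2 / v^2. This bounds \<open>G s\<close> by 8 / (K
  R^2) for every \<open>R\<close>. Nothing is asked of \<open>G\<close> at its zeros beyond
  continuity.\<close>

lemma ahlfors_schwarz_vanishing:
  fixes G :: "complex \<Rightarrow> real"
  assumes cont: "continuous_on UNIV G" and nonneg: "\<And>z. G z \<ge> 0" and K: "K > 0"
    and curv: "\<And>t. G t > 0 \<Longrightarrow> \<exists>c L. second_order_at (\<lambda>z. ln (G z)) t c L \<and> L \<ge> K * G t"
  shows "G s = 0"
proof (rule ccontr)
  assume "G s \<noteq> 0"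
  then have Gs: "G s > 0" using nonneg[of s] by simp
  have bound: "G s * R^2 \<le> 8 / K" if R: "R > 0" for R
  proof -
    define v where "v = (\<lambda>z. R^2 - (cmod (z - s))^2)"
    have vc: "continuous_on A v" for A
      unfolding v_def by (intro continuous_intros)
    have Gc: "continuous_on A G" for A
      using cont continuous_on_subset by blast
    obtain t where t: "t \<in> cball s R" and max: "\<And>z. z \<in> cball s R \<Longrightarrow> G z * (v z)^2 \<le> G t * (v t)^2"
      using continuous_attains_sup[of "cball s R" "\<lambda>z. G z * (v z)^2"] R
      by (force intro!: continuous_intros vc Gc)
    have "G s * (v s)^2 > 0" using Gs R by (simp add: v_def)
    with max[of s] R have pos: "G t * (v t)^2 > 0" by simp
    then have Gt: "G t > 0" using nonneg[of t] by (cases "G t = 0") auto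
    have vt0: "v t \<noteq> 0" using pos by auto
    have "cmod (t - s) \<le> R" using t by (simp add: dist_norm norm_minus_commute)
    then have "(cmod (t - s))^2 \<le> R^2" by (simp add: power_mono)
    with vt0 have vt: "v t > 0" by (simp add: v_def)
    obtain c L where L: "second_order_at (\<lambda>z. ln (G z)) t c L" "L \<ge> K * G t"
      using curv[OF Gt] by blast
    have "second_order_at (\<lambda>z. (cmod (z - s))^2) t (2 * cnj (t - s) * deriv (\<lambda>z. z - s) t) (4 * (cmod (deriv (\<lambda>z. z - s) t))^2)"
      by (rule second_order_at_norm_square[where S = UNIV]) (auto intro!: holomorphic_intros)
    moreover have "deriv (\<lambda>z. z - s) t = 1"
      by (auto intro!: DERIV_imp_deriv derivative_eq_intros)
    ultimately have "second_order_at (\<lambda>z. (cmod (z - s))^2) t (2 * cnj (t - s)) 4" by simp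
    from second_order_at_diff[OF second_order_at_const[of "R^2"] this]
    have "second_order_at v t (- 2 * cnj (t - s)) (- 4)" by (simp add: v_def)
    from second_order_at_ln[OF this vt]
    have v2: "second_order_at (\<lambda>z. ln (v z)) t (- 2 * cnj (t - s) / of_real (v t)) (- 4 / v t - (cmod (- 2 * cnj (t - s)))^2 / (v t)^2)" .
    have "- 4 / v t - (cmod (- 2 * cnj (t - s)))^2 / (v t)^2 = - 4 * (v t + (cmod (t - s))^2) / (v t)^2"
    proof -
      have "cmod (- 2 * cnj (t - s)) = 2 * cmod (t - s)"
        by (simp only: norm_mult complex_mod_cnj) simp
      then show ?thesis using vt by (simp only: power_mult_distrib) (simp add: power2_eq_square field_simps)
    qed
    also have "v t + (cmod (t - s))^2 = R^2" by (simp add: v_def)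
    finally have "second_order_at (\<lambda>z. ln (v z)) t (- 2 * cnj (t - s) / of_real (v t)) (- 4 * R^2 / (v t)^2)"
      using v2 by simp
    from second_order_at_add[OF L(1) second_order_at_cmult[OF this, of 2]]
    have so: "second_order_at (\<lambda>z. ln (G z) + 2 * ln (v z)) t (c + of_real 2 * (- 2 * cnj (t - s) / of_real (v t))) (L + 2 * (- 4 * R^2 / (v t)^2))" .
    have ev: "\<forall>\<^sub>F z in at t. G z > 0 \<and> v z > 0"
    proof -
      have "(G \<longlongrightarrow> G t) (at t)" "(v \<longlongrightarrow> v t) (at t)"
        using cont vc[of UNIV] by (auto simp: continuous_on_eq_continuous_at isCont_def)
      from order_tendstoD(1)[OF this(1) Gt] order_tendstoD(1)[OF this(2) vt]
      show ?thesis by (rule eventually_conj)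
    qed
    have "\<forall>\<^sub>F z in at t. ln (G z) + 2 * ln (v z) \<le> ln (G t) + 2 * ln (v t)"
      using ev
    proof eventually_elim
      case (elim z)
      have lnphi: "ln (G z) + 2 * ln (v z) = ln (G z * (v z)^2)" if "G z > 0" "v z > 0" for z
        using that by (simp add: ln_mult ln_realpow)
      have "(cmod (z - s))^2 \<le> R^2" using elim by (simp add: v_def)
      then have "cmod (z - s) \<le> R" by (rule power2_le_imp_le) (use R in simp)
      then have "z \<in> cball s R" by (simp add: dist_norm norm_minus_commute)
      from max[OF this] show ?case
        using elim Gt vt pos by (simp add: lnphi)
    qed
    from second_order_at_local_max[OF so this] L(2)
    have "K * G t \<le> 8 * R^2 / (v t)^2" by simp
    then have "K * (G t * (v t)^2) \<le> 8 * R^2" using vt by (simp add: pos_le_divide_eq mult.assoc)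
    moreover have "G s * (v s)^2 \<le> G t * (v t)^2" using max[of s] R by simp
    then have "K * (G s * (v s)^2) \<le> K * (G t * (v t)^2)" using K by simp
    ultimately have "K * (G s * (R^2 * R^2)) \<le> 8 * R^2" by (simp add: v_def power2_eq_square)
    then have "(K * (G s * R^2)) * R^2 \<le> 8 * R^2" by (simp add: mult.assoc)
    then have "K * (G s * R^2) \<le> 8" using R by (simp only: mult_le_cancel_right) auto
    then show ?thesis using K by (simp add: pos_le_divide_eq mult.commute)
  qed
  \<comment> \<open>Chosen so that \<open>G s * R^2\<close> exceeds the bound \<open>8 / K\<close>
    by exactly \<open>G s\<close>.\<close>
  define R where "R = sqrt (8 / (K * G s) + 1)"
  have "R > 0" using K Gs by (simp add: R_def add_pos_pos)
  moreover have "R^2 = 8 / (K * G s) + 1" using K Gs by (simp add: R_def)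
  ultimately have "G s * (8 / (K * G s) + 1) \<le> 8 / K" using bound by metis
  moreover have "G s * (8 / (K * G s) + 1) = 8 / K + G s" using K Gs by (simp add: field_simps)
  ultimately show False using Gs by simp
qed

section \<open>Negatively curved cone metrics\<close>

lemma lagrange_identity_complex:
  "((cmod p)^2 + (cmod q)^2) * ((cmod x)^2 + (cmod y)^2) =
     (cmod (cnj p * x + cnj q * y))^2 + (cmod (p * y - q * x))^2"
  unfolding cmod_power2 by (simp add: power2_eq_square algebra_simps)

definition wronskian :: "(complex \<Rightarrow> complex) \<Rightarrow> (complex \<Rightarrow> complex) \<Rightarrow> complex \<Rightarrow> complex" where
  "wronskian p q z = p z * deriv q z - q z * deriv p z"

lemma wronskian_holomorphic [holomorphic_intros]:
  assumes "p holomorphic_on UNIV" "q holomorphic_on UNIV"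
  shows "wronskian p q holomorphic_on UNIV"
  unfolding wronskian_def[abs_def] using assms by (intro holomorphic_intros) auto

lemma deriv_linear_combination:
  assumes "p holomorphic_on UNIV" "q holomorphic_on UNIV"
  shows "deriv (\<lambda>z. a * p z + b * q z) t = a * deriv p t + b * deriv q t"
proof -
  have "(p has_field_derivative deriv p t) (at t)" "(q has_field_derivative deriv q t) (at t)"
    using assms by (auto intro: holomorphic_derivI[OF _ open_UNIV])
  then show ?thesis by (auto intro!: DERIV_imp_deriv derivative_eq_intros)
qed

lemma second_order_at_ln_norm_holomorphic:
  assumes f: "f holomorphic_on UNIV" and "f t \<noteq> 0"
  shows "second_order_at (\<lambda>z. ln ((cmod (f z))^2)) t (2 * deriv f t / f t) 0"
proof -
  have 1: "2 * cnj (f t) * deriv f t / of_real ((cmod (f t))^2) = 2 * deriv f t / f t"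
    using assms(2) unfolding complex_norm_square by (simp add: field_simps)
  have 2: "4 * (cmod (deriv f t))^2 / (cmod (f t))^2 - (cmod (2 * cnj (f t) * deriv f t))^2 / ((cmod (f t))^2)^2 = 0"
    using assms(2) by (simp add: norm_mult power_mult_distrib power2_eq_square)
  show ?thesis
    using second_order_at_ln[OF second_order_at_norm_square[OF f open_UNIV UNIV_I, of t]] assms(2)
    unfolding 1 2 by simp
qed

section \<open>The Fubini-Study metric along a lifted curve\<close>

locale projective_curve =
  fixes p q :: "complex \<Rightarrow> complex"
  assumes hol: "p holomorphic_on UNIV" "q holomorphic_on UNIV"
    and no_common_zero: "p z \<noteq> 0 \<or> q z \<noteq> 0"
begin

definition N :: "complex \<Rightarrow> real" where "N z = (cmod (p z))^2 + (cmod (q z))^2"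
definition W :: "complex \<Rightarrow> complex" where "W = wronskian p q"
text \<open>\<open>A\<close> is the squared density of the pullback of the Fubini-Study metric.\<close>

definition A :: "complex \<Rightarrow> real" where "A z = (cmod (W z))^2 / (N z)^2"
definition lf :: "complex \<Rightarrow> complex \<Rightarrow> complex \<Rightarrow> complex" where "lf a b z = a * p z + b * q z"
text \<open>The squared chordal distance from the curve to the zero of the form, scaled by
  \<open>(cmod a)^2 + (cmod b)^2\<close>.\<close>

definition rat :: "complex \<Rightarrow> complex \<Rightarrow> complex \<Rightarrow> real" where "rat a b z = (cmod (lf a b z))^2 / N z"

lemma N_pos: "N z > 0"
  using no_common_zero[of z] by (auto simp: N_def add_pos_nonneg add_nonneg_pos)

lemma lf_holomorphic: "lf a b holomorphic_on UNIV"
  unfolding lf_def[abs_def] by (intro holomorphic_intros hol)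

text \<open>\<open>ln N\<close> is the potential of the Fubini-Study metric: in its Laplacian the
  Lagrange identity collapses the squared derivatives minus the gradient term to
  \<open>(cmod (W t))^2\<close>.\<close>

lemma second_order_ln_N:
  "second_order_at (\<lambda>z. ln (N z)) t (2 * (cnj (p t) * deriv p t + cnj (q t) * deriv q t) / of_real (N t)) (4 * A t)"
proof -
  have "second_order_at N t (2 * cnj (p t) * deriv p t + 2 * cnj (q t) * deriv q t) (4 * (cmod (deriv p t))^2 + 4 * (cmod (deriv q t))^2)"
    unfolding N_def[abs_def]
    by (intro second_order_at_add second_order_at_norm_square[where S = UNIV] hol) auto
  from second_order_at_ln[OF this N_pos]
  have so: "second_order_at (\<lambda>z. ln (N z)) t ((2 * cnj (p t) * deriv p t + 2 * cnj (q t) * deriv q t) / of_real (N t))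
      ((4 * (cmod (deriv p t))^2 + 4 * (cmod (deriv q t))^2) / N t - (cmod (2 * cnj (p t) * deriv p t + 2 * cnj (q t) * deriv q t))^2 / (N t)^2)" .
  have 1: "2 * cnj (p t) * deriv p t + 2 * cnj (q t) * deriv q t = 2 * (cnj (p t) * deriv p t + cnj (q t) * deriv q t)"
    by (simp add: algebra_simps)
  have "N t * ((cmod (deriv p t))^2 + (cmod (deriv q t))^2) - (cmod (cnj (p t) * deriv p t + cnj (q t) * deriv q t))^2 = (cmod (W t))^2"
    using lagrange_identity_complex[of "p t" "q t" "deriv p t" "deriv q t"] by (simp add: N_def W_def wronskian_def)
  moreover have "(4 * x + 4 * y) / n - 2^2 * w / n^2 = 4 * (v / n^2)" if "n * (x + y) - w = v" "n > 0" for n x y v w :: real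
    using that(2) by (simp add: that(1)[symmetric] power2_eq_square field_simps)
  ultimately have 2: "(4 * (cmod (deriv p t))^2 + 4 * (cmod (deriv q t))^2) / N t - (cmod (2 * (cnj (p t) * deriv p t + cnj (q t) * deriv q t)))^2 / (N t)^2 = 4 * A t"
    using N_pos[of t] unfolding A_def norm_mult power_mult_distrib norm_numeral by blast
  show ?thesis using so unfolding 1 2 .
qed

text \<open>The Pythagorean relation between a form and its Hermitian orthogonal one. It yields the
  upper bound for \<open>rat\<close> and, since the orthogonal form appears in the gradient of
  \<open>ln rat\<close>, the length of that gradient.\<close>

lemma rat_identity:
  "rat a b t * N t + (cmod (b * cnj (p t) - a * cnj (q t)))^2 = ((cmod a)^2 + (cmod b)^2) * N t"
proof -
  have "rat a b t * N t = (cmod (lf a b t))^2" using N_pos[of t] by (simp add: rat_def)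
  then show ?thesis
    unfolding lf_def N_def cmod_power2 by (simp add: power2_eq_square algebra_simps)
qed

lemma rat_le: "rat a b t \<le> (cmod a)^2 + (cmod b)^2"
proof -
  have "rat a b t * N t \<le> ((cmod a)^2 + (cmod b)^2) * N t"
    using rat_identity[of a b t] zero_le_power2[of "cmod (b * cnj (p t) - a * cnj (q t))"] by linarith
  then show ?thesis using N_pos[of t] by simp
qed

text \<open>With \<open>ln |lf|^2\<close> harmonic, \<open>ln rat\<close> has Laplacian
  \<open>-4 * A t\<close>, and its gradient has squared length \<open>4 * A t * (C / r - 1)\<close>.
  The gradient term makes the Laplacian of \<open>rat powr \<delta>\<close> blow up like
  \<open>r powr (\<delta> - 1)\<close> relative to \<open>A\<close>, which is the point of using
  this function as a correction.\<close>

lemma second_order_rat_powr: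
  assumes "lf a b t \<noteq> 0"
  defines "C \<equiv> (cmod a)^2 + (cmod b)^2" and "r \<equiv> rat a b t"
  shows "\<exists>c. second_order_at (\<lambda>z. exp (\<delta> * (ln ((cmod (lf a b z))^2) - ln (N z)))) t c
      (4 * \<delta> * A t * (r powr \<delta>) * (\<delta> * C / r - \<delta> - 1))"
proof -
  have Np: "N t > 0" by (rule N_pos)
  define c where "c = 2 * deriv (lf a b) t / lf a b t - 2 * (cnj (p t) * deriv p t + cnj (q t) * deriv q t) / of_real (N t)"
  have so: "second_order_at (\<lambda>z. ln ((cmod (lf a b z))^2) - ln (N z)) t c (- 4 * A t)"
    using second_order_at_diff[OF second_order_at_ln_norm_holomorphic[OF lf_holomorphic assms(1)] second_order_ln_N[of t]]
    unfolding c_def by simp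
  have rpos: "r > 0" using Np assms(1) by (simp add: r_def rat_def)
  have dl: "deriv (lf a b) t = a * deriv p t + b * deriv q t"
    unfolding lf_def[abs_def] by (rule deriv_linear_combination[OF hol])
  have Nc: "of_real (N t) = p t * cnj (p t) + q t * cnj (q t)"
    unfolding N_def by (simp add: complex_norm_square del: of_real_power)
  have "c = 2 * (deriv (lf a b) t * of_real (N t) - (cnj (p t) * deriv p t + cnj (q t) * deriv q t) * lf a b t) / (lf a b t * of_real (N t))"
    using assms(1) Np by (simp add: c_def field_simps)
  also have "deriv (lf a b) t * of_real (N t) - (cnj (p t) * deriv p t + cnj (q t) * deriv q t) * lf a b t
      = (b * cnj (p t) - a * cnj (q t)) * W t"
    unfolding dl Nc lf_def W_def wronskian_def by (simp add: algebra_simps)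
  finally have "(cmod c)^2 = 4 * (cmod (b * cnj (p t) - a * cnj (q t)))^2 * (cmod (W t))^2 / ((cmod (lf a b t))^2 * (N t)^2)"
    using Np by (simp add: norm_mult norm_divide power_mult_distrib power_divide)
  also have "(cmod (b * cnj (p t) - a * cnj (q t)))^2 = (C - r) * N t"
    using rat_identity[of a b t] by (simp add: C_def r_def algebra_simps)
  also have "(cmod (lf a b t))^2 = r * N t" using Np by (simp add: r_def rat_def)
  also have "4 * ((C - r) * N t) * (cmod (W t))^2 / (r * N t * (N t)^2) = 4 * A t * (C / r - 1)"
    using Np rpos by (simp add: A_def divide_simps)
  finally have c2: "(cmod c)^2 = 4 * A t * (C / r - 1)" .
  have ex: "exp (\<delta> * (ln ((cmod (lf a b t))^2) - ln (N t))) = r powr \<delta>"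
    using rpos Np assms(1) by (simp add: powr_def r_def rat_def ln_div)
  have "second_order_at (\<lambda>z. exp (\<delta> * (ln ((cmod (lf a b z))^2) - ln (N z)))) t
      (of_real (r powr \<delta>) * (of_real \<delta> * c)) (r powr \<delta> * (\<delta> * (- 4 * A t) + (cmod (of_real \<delta> * c))^2))"
    using second_order_at_exp[OF second_order_at_cmult[OF so, of \<delta>]] unfolding ex .
  moreover have "r powr \<delta> * (\<delta> * (- 4 * A t) + (cmod (of_real \<delta> * c))^2) = 4 * \<delta> * A t * (r powr \<delta>) * (\<delta> * C / r - \<delta> - 1)"
    unfolding norm_mult power_mult_distrib c2 using rpos by (simp add: field_simps power2_eq_square)
  ultimately show ?thesis by metis
qed

end

text \<open>At most one \<open>r i\<close> lies below \<open>\<kappa>\<close>. With the smallest one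
  singled out, every other factor is at most \<open>\<kappa> powr (-\<theta>)\<close>.\<close>

lemma prod_powr_le_one_factor:
  fixes r :: "'i \<Rightarrow> real"
  assumes I: "finite I" "I \<noteq> {}" and pos: "\<And>i. i \<in> I \<Longrightarrow> r i > 0" and "\<kappa> > 0" "\<theta> > 0"
    and sep: "\<And>i j. i \<in> I \<Longrightarrow> j \<in> I \<Longrightarrow> i \<noteq> j \<Longrightarrow> r i \<ge> \<kappa> \<or> r j \<ge> \<kappa>"
  shows "\<exists>i\<in>I. (\<Prod>i\<in>I. r i powr (-\<theta>)) \<le> (\<kappa> powr (-\<theta>)) ^ (card I - 1) * r i powr (-\<theta>)"
proof -
  obtain k where k: "k \<in> I" "\<And>i. i \<in> I \<Longrightarrow> r k \<le> r i"
  proof -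
    have "Min (r ` I) \<in> r ` I" using I by (intro Min_in) auto
    then obtain k where "k \<in> I" "Min (r ` I) = r k" by auto
    then show ?thesis using that[of k] I by (metis Min_le finite_imageI imageI)
  qed
  have ge: "r i \<ge> \<kappa>" if "i \<in> I - {k}" for i
    using sep[of i k] k that by force
  have "(\<Prod>i\<in>I. r i powr (-\<theta>)) = r k powr (-\<theta>) * (\<Prod>i\<in>I - {k}. r i powr (-\<theta>))"
    using I k by (simp add: prod.remove)
  also have "\<dots> \<le> r k powr (-\<theta>) * (\<Prod>i\<in>I - {k}. \<kappa> powr (-\<theta>))"
    using ge assms(4,5) by (intro mult_left_mono prod_mono) (auto intro: powr_mono2')
  also have "\<dots> = (\<kappa> powr (-\<theta>)) ^ (card I - 1) * r k powr (-\<theta>)"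
    using I k by (simp add: card_Diff_singleton)
  finally show ?thesis using k by blast
qed

section \<open>Cone metrics with several cone points\<close>

locale lines =
  fixes I :: "'i set" and a b :: "'i \<Rightarrow> complex"
  assumes finite_I: "finite I"
    and indep: "\<And>i j. i \<in> I \<Longrightarrow> j \<in> I \<Longrightarrow> i \<noteq> j \<Longrightarrow> a i * b j \<noteq> a j * b i"

locale curve_and_lines = projective_curve p q + lines I a b
  for p q :: "complex \<Rightarrow> complex" and I :: "'i set" and a b :: "'i \<Rightarrow> complex"
begin

abbreviation "f i \<equiv> lf (a i) (b i)"
abbreviation "r i \<equiv> rat (a i) (b i)"
definition C :: "'i \<Rightarrow> real" where "C i = (cmod (a i))^2 + (cmod (b i))^2"

lemma r_le: "r i t \<le> C i"
  using rat_le by (simp add: C_def)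

lemma r_pos: "f i t \<noteq> 0 \<Longrightarrow> r i t > 0"
  using N_pos[of t] by (simp add: rat_def)

lemma r_nonneg: "r i t \<ge> 0"
  using N_pos[of t] by (simp add: rat_def)

lemma C_pos: "a i \<noteq> 0 \<or> b i \<noteq> 0 \<Longrightarrow> C i > 0"
  by (auto simp: C_def sum_power2_gt_zero_iff)

text \<open>By Cramer's rule \<open>p\<close> and \<open>q\<close> are combinations of any two of
  the forms, so two of them cannot both be small compared with the norm of the lift, uniformly in
  \<open>t\<close>.\<close>

lemma separated: "\<exists>\<kappa>>0. \<forall>t. \<forall>i\<in>I. \<forall>j\<in>I. i \<noteq> j \<longrightarrow> r i t \<ge> \<kappa> \<or> r j t \<ge> \<kappa>"
proof -
  define m where "m = (\<lambda>(i, j). (cmod (a i * b j - a j * b i))^2 / (C i + C j))"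
  \<comment> \<open>The extra 1 keeps the minimum defined when there is no pair of indices. The half
    is taken because \<open>r i t + r j t \<ge> 2 * \<kappa>\<close> forces one summand to be at
    least \<open>\<kappa>\<close>.\<close>
  define \<kappa> where "\<kappa> = Min (insert 1 (m ` {(i, j). i \<in> I \<and> j \<in> I \<and> i \<noteq> j})) / 2"
  have fin: "finite (m ` {(i, j). i \<in> I \<and> j \<in> I \<and> i \<noteq> j})"
    by (rule finite_imageI, rule finite_subset[of _ "I \<times> I"]) (auto simp: finite_I)
  have Cpos: "C i + C j > 0" if "i \<in> I" "j \<in> I" "i \<noteq> j" for i j
  proof -
    have "a i \<noteq> 0 \<or> b i \<noteq> 0" using indep[OF that] by auto
    then have "C i > 0" by (rule C_pos)
    moreover have "C j \<ge> 0" by (simp add: C_def)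
    ultimately show ?thesis by linarith
  qed
  have "\<kappa> > 0"
  proof -
    have "m (i, j) > 0" if "i \<in> I" "j \<in> I" "i \<noteq> j" for i j
      using Cpos[OF that] indep[OF that] by (simp add: m_def)
    then show ?thesis unfolding \<kappa>_def using fin by (subst zero_less_divide_iff, subst Min_gr_iff) auto
  qed
  moreover have "r i t \<ge> \<kappa> \<or> r j t \<ge> \<kappa>" if ij: "i \<in> I" "j \<in> I" "i \<noteq> j" for i j t
  proof -
    define D where "D = a i * b j - a j * b i"
    have Np: "N t > 0" by (rule N_pos)
    have p: "D * p t = b j * f i t + (- b i) * f j t" and q: "D * q t = (- a j) * f i t + a i * f j t"
      unfolding D_def lf_def by (simp_all add: algebra_simps)
    have cs: "(cmod (x * u + y * v))^2 \<le> ((cmod x)^2 + (cmod y)^2) * ((cmod u)^2 + (cmod v)^2)" for x y u v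
      using lagrange_identity_complex[of "cnj x" "cnj y" u v] zero_le_power2[of "cmod (cnj x * v - cnj y * u)"] by simp
    have "(cmod D)^2 * N t = (cmod (D * p t))^2 + (cmod (D * q t))^2"
      unfolding N_def norm_mult power_mult_distrib by (simp add: algebra_simps)
    also have "\<dots> \<le> ((cmod (b j))^2 + (cmod (- b i))^2) * ((cmod (f i t))^2 + (cmod (f j t))^2)
        + ((cmod (- a j))^2 + (cmod (a i))^2) * ((cmod (f i t))^2 + (cmod (f j t))^2)"
      unfolding p q by (intro add_mono cs)
    also have "\<dots> = (C i + C j) * ((cmod (f i t))^2 + (cmod (f j t))^2)"
      unfolding C_def by (simp add: algebra_simps)
    also have "(cmod (f i t))^2 + (cmod (f j t))^2 = (r i t + r j t) * N t"
      using Np by (simp add: rat_def field_simps)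
    finally have "(cmod D)^2 * N t \<le> ((C i + C j) * (r i t + r j t)) * N t" by (simp add: mult.assoc)
    then have "(cmod D)^2 \<le> (C i + C j) * (r i t + r j t)" using Np by simp
    then have "(cmod D)^2 / (C i + C j) \<le> r i t + r j t"
      using Cpos[OF ij] by (simp add: pos_divide_le_eq mult.commute)
    then have "m (i, j) \<le> r i t + r j t" by (simp add: m_def D_def)
    moreover have "Min (insert 1 (m ` {(i, j). i \<in> I \<and> j \<in> I \<and> i \<noteq> j})) \<le> m (i, j)"
      using fin ij by (intro Min_le) auto
    then have "2 * \<kappa> \<le> m (i, j)" by (simp add: \<kappa>_def)
    ultimately show ?thesis using \<open>\<kappa> > 0\<close> by linarith
  qed
  ultimately show ?thesis by blast
qed

text \<open>
  \<open>Psi\<close> is the logarithm of \<open>A * \<Prod>i\<in>I. r i powr (-\<theta>)\<close>, a squared cone metric, corrected by a factor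
  \<open>exp (\<eta> * \<dots>)\<close>.  Away from the cone points its curvature is negative because
  \<open>card I * \<theta> > 2\<close>; the correction contributes a term of order \<open>r i powr (-\<theta>)\<close> to the
  Laplacian, which matches the blow-up of the metric at the cone points.
\<close>

definition Psi :: "real \<Rightarrow> real \<Rightarrow> complex \<Rightarrow> real" where
  "Psi \<theta> \<eta> z = ln ((cmod (W z))^2) + (real (card I) * \<theta> - 2) * ln (N z) - \<theta> * (\<Sum>i\<in>I. ln ((cmod (f i z))^2))
     + \<eta> * (\<Sum>i\<in>I. exp ((1 - \<theta>) * (ln ((cmod (f i z))^2) - ln (N z))))"

text \<open>The logarithms of \<open>W\<close> and of the forms are harmonic here, so only
  \<open>ln N\<close> and the correction contribute.\<close>

lemma second_order_Psi:
  assumes W: "W t \<noteq> 0" and f: "\<And>i. i \<in> I \<Longrightarrow> f i t \<noteq> 0"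
  shows "\<exists>c. second_order_at (Psi \<theta> \<eta>) t c
     (4 * A t * ((real (card I) * \<theta> - 2) + \<eta> * (1 - \<theta>) * (\<Sum>i\<in>I. r i t powr (1 - \<theta>) * ((1 - \<theta>) * C i / r i t - (1 - \<theta>) - 1))))"
proof -
  define \<delta> where "\<delta> = 1 - \<theta>"
  have "\<forall>i\<in>I. \<exists>c. second_order_at (\<lambda>z. exp (\<delta> * (ln ((cmod (f i z))^2) - ln (N z)))) t c
      (4 * \<delta> * A t * (r i t powr \<delta>) * (\<delta> * C i / r i t - \<delta> - 1))"
    using second_order_rat_powr[OF f] unfolding C_def by blast
  from bchoice[OF this] obtain c where c: "\<And>i. i \<in> I \<Longrightarrow> second_order_at (\<lambda>z. exp (\<delta> * (ln ((cmod (f i z))^2) - ln (N z)))) t (c i)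
      (4 * \<delta> * A t * (r i t powr \<delta>) * (\<delta> * C i / r i t - \<delta> - 1))"
    by blast
  have "W holomorphic_on UNIV" unfolding W_def by (intro holomorphic_intros hol)
  note so = second_order_at_add[OF second_order_at_diff[OF second_order_at_add[OF
      second_order_at_ln_norm_holomorphic[OF \<open>W holomorphic_on UNIV\<close> W]
      second_order_at_cmult[OF second_order_ln_N, of "real (card I) * \<theta> - 2"]]
      second_order_at_cmult[OF second_order_at_sum[OF second_order_at_ln_norm_holomorphic[OF lf_holomorphic f]], of _ _ \<theta>]]
      second_order_at_cmult[OF second_order_at_sum[OF c], of _ _ \<eta>]]
  have "\<exists>c. second_order_at (Psi \<theta> \<eta>) t c
     (0 + (real (card I) * \<theta> - 2) * (4 * A t) - \<theta> * (\<Sum>i\<in>I. 0) + \<eta> * (\<Sum>i\<in>I. 4 * \<delta> * A t * (r i t powr \<delta>) * (\<delta> * C i / r i t - \<delta> - 1)))"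
    unfolding Psi_def[abs_def] \<delta>_def[symmetric] by (rule exI) (rule so, assumption+)
  also have "0 + (real (card I) * \<theta> - 2) * (4 * A t) - \<theta> * (\<Sum>i\<in>I. 0) + \<eta> * (\<Sum>i\<in>I. 4 * \<delta> * A t * (r i t powr \<delta>) * (\<delta> * C i / r i t - \<delta> - 1))
    = 4 * A t * ((real (card I) * \<theta> - 2) + \<eta> * \<delta> * (\<Sum>i\<in>I. r i t powr \<delta> * (\<delta> * C i / r i t - \<delta> - 1)))"
    unfolding sum_distrib_left distrib_left by (simp add: mult_ac)
  finally show ?thesis unfolding \<delta>_def .
qed

lemma exp_Psi:
  assumes W: "W t \<noteq> 0" and f: "\<And>i. i \<in> I \<Longrightarrow> f i t \<noteq> 0"
  shows "exp (Psi \<theta> \<eta> t) = A t * (\<Prod>i\<in>I. r i t powr (-\<theta>)) * exp (\<eta> * (\<Sum>i\<in>I. r i t powr (1 - \<theta>)))"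
proof -
  have Np: "N t > 0" by (rule N_pos)
  have lr: "ln (r i t) = ln ((cmod (f i t))^2) - ln (N t)" if "i \<in> I" for i
    using f[OF that] Np by (simp add: rat_def ln_div)
  have e: "exp ((1 - \<theta>) * (ln ((cmod (f i t))^2) - ln (N t))) = r i t powr (1 - \<theta>)" if "i \<in> I" for i
    using r_pos[OF f[OF that]] by (simp add: powr_def lr[OF that])
  have linear_identity: "-\<theta> * (x - y) = -\<theta> * x + \<theta> * y" for x y :: real
    by (simp add: algebra_simps)
  have "(\<Prod>i\<in>I. r i t powr (-\<theta>)) = (\<Prod>i\<in>I. exp (-\<theta> * ln (r i t)))"
    using r_pos[OF f] by (intro prod.cong refl) (auto simp: powr_def dest: r_pos[OF f])
  also have "\<dots> = exp (\<Sum>i\<in>I. -\<theta> * ln (r i t))"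
    by (simp only: exp_sum[OF finite_I])
  also have "(\<Sum>i\<in>I. -\<theta> * ln (r i t)) = (\<Sum>i\<in>I. -\<theta> * ln ((cmod (f i t))^2) + \<theta> * ln (N t))"
  proof (intro sum.cong refl)
    fix i assume "i \<in> I"
    show "-\<theta> * ln (r i t) = -\<theta> * ln ((cmod (f i t))^2) + \<theta> * ln (N t)"
      unfolding lr[OF \<open>i \<in> I\<close>] by (rule linear_identity)
  qed
  also have "\<dots> = -\<theta> * (\<Sum>i\<in>I. ln ((cmod (f i t))^2)) + real (card I) * \<theta> * ln (N t)"
    by (simp only: sum.distrib sum_distrib_left sum_constant mult.assoc)
  finally have P: "(\<Prod>i\<in>I. r i t powr (-\<theta>)) = exp (-\<theta> * (\<Sum>i\<in>I. ln ((cmod (f i t))^2)) + real (card I) * \<theta> * ln (N t))" .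
  have "A t = exp (ln ((cmod (W t))^2) - 2 * ln (N t))"
    using W Np by (simp add: A_def exp_diff exp_of_nat_mult[of 2, simplified] flip: ln_realpow)
  then have "A t * (\<Prod>i\<in>I. r i t powr (-\<theta>)) * exp (\<eta> * (\<Sum>i\<in>I. r i t powr (1 - \<theta>))) =
      exp ((ln ((cmod (W t))^2) - 2 * ln (N t)) + (-\<theta> * (\<Sum>i\<in>I. ln ((cmod (f i t))^2)) + real (card I) * \<theta> * ln (N t)) + \<eta> * (\<Sum>i\<in>I. r i t powr (1 - \<theta>)))"
    unfolding P exp_add by simp
  also have "\<dots> = exp (Psi \<theta> \<eta> t)"
    using e by (simp add: Psi_def algebra_simps)
  finally show ?thesis by simp
qed

text \<open>After the bounded negative part of the correction has been paid for by
  \<open>real (card I) * \<theta> - 2\<close>, a positive multiple of \<open>A t * T\<close>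
  remains, where \<open>T\<close> sums \<open>C i * r i t powr (-\<theta>)\<close>. Since at most
  one \<open>r i t\<close> is small, the whole product of cone factors is bounded by a multiple of
  one summand of \<open>T\<close>, so the same quantity controls the metric itself.\<close>

lemma curvature:
  assumes th: "0 < \<theta>" "\<theta> < 1" and big: "real (card I) * \<theta> > 2"
  shows "\<exists>\<eta>>0. \<exists>K>0. \<forall>t. W t \<noteq> 0 \<longrightarrow> (\<forall>i\<in>I. f i t \<noteq> 0) \<longrightarrow>
           (\<exists>c L. second_order_at (Psi \<theta> \<eta>) t c L \<and> L \<ge> K * exp (Psi \<theta> \<eta> t))"
proof -
  define \<delta> where "\<delta> = 1 - \<theta>"
  have d: "\<delta> > 0" "\<delta> < 1" using th by (auto simp: \<delta>_def)
  have "card I \<ge> 2"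
  proof (rule ccontr)
    assume "\<not> card I \<ge> 2"
    then have "real (card I) * \<theta> \<le> 1 * 1" using th by (intro mult_mono) auto
    then show False using big by simp
  qed
  then have ne: "I \<noteq> {}" by auto
  \<comment> \<open>A zero form would be dependent on every other form, and there is another
    one.\<close>
  have Cpos: "C i > 0" if "i \<in> I" for i
  proof -
    have "\<exists>j\<in>I. j \<noteq> i"
    proof (rule ccontr)
      assume "\<not> (\<exists>j\<in>I. j \<noteq> i)"
      then have "I \<subseteq> {i}" by auto
      then show False using \<open>card I \<ge> 2\<close> card_mono[of "{i}" I] by simp
    qed
    then obtain j where "j \<in> I" "i \<noteq> j" by blast
    then have "a i \<noteq> 0 \<or> b i \<noteq> 0" using indep[OF that] by auto
    then show ?thesis by (rule C_pos)
  qed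
  define S where "S = (\<Sum>i\<in>I. C i powr \<delta>)"
  have "S > 0" unfolding S_def by (intro sum_pos finite_I ne) (use Cpos in force)
  \<comment> \<open>Solves \<open>\<eta> * \<delta> * (1 + \<delta>) * S = real (card I) * \<theta>
    - 2\<close>: the largest correction whose negative part, bounded through \<open>S\<close>, is
    still absorbed.\<close>
  define \<eta> where "\<eta> = (real (card I) * \<theta> - 2) / (\<delta> * (1 + \<delta>) * S)"
  have eta: "\<eta> > 0" using big d \<open>S > 0\<close> by (simp add: \<eta>_def)
  have eta_eq: "\<eta> * \<delta> * (1 + \<delta>) * S = real (card I) * \<theta> - 2"
    using d \<open>S > 0\<close> by (simp add: \<eta>_def)
  obtain \<kappa> where \<kappa>: "\<kappa> > 0" "\<And>t i j. i \<in> I \<Longrightarrow> j \<in> I \<Longrightarrow> i \<noteq> j \<Longrightarrow> r i t \<ge> \<kappa> \<or> r j t \<ge> \<kappa>"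
    using separated by blast
  define Cm where "Cm = Min (C ` I)"
  have Cm: "Cm > 0" "\<And>i. i \<in> I \<Longrightarrow> Cm \<le> C i"
    using Cpos finite_I ne by (auto simp: Cm_def)
  define B where "B = (\<kappa> powr (-\<theta>)) ^ (card I - 1) * exp (\<eta> * S)"
  have B: "B > 0" using \<kappa> by (simp add: B_def)
  \<comment> \<open>The Laplacian is at least \<open>4 * \<eta> * \<delta>^2 * Cm\<close> times
    \<open>A t * r k t powr (-\<theta>)\<close>, and the metric is at most \<open>B\<close> times
    the same quantity; \<open>K\<close> is the quotient.\<close>
  define K where "K = 4 * \<eta> * \<delta>^2 * Cm / B"
  have "K > 0" using eta d Cm B by (simp add: K_def)
  moreover have "\<exists>c L. second_order_at (Psi \<theta> \<eta>) t c L \<and> L \<ge> K * exp (Psi \<theta> \<eta> t)"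
    if W: "W t \<noteq> 0" and f: "\<forall>i\<in>I. f i t \<noteq> 0" for t
  proof -
    have rp: "r i t > 0" if "i \<in> I" for i using r_pos f that by blast
    have A0: "A t \<ge> 0" by (simp add: A_def)
    define T where "T = (\<Sum>i\<in>I. C i * r i t powr (-\<theta>))"
    have rS: "(\<Sum>i\<in>I. r i t powr \<delta>) \<le> S"
      unfolding S_def using rp d by (intro sum_mono powr_mono2) (auto simp: r_le intro: less_imp_le)
    have "(\<Sum>i\<in>I. r i t powr \<delta> * (\<delta> * C i / r i t - \<delta> - 1)) = (\<Sum>i\<in>I. \<delta> * (C i * r i t powr (-\<theta>)) - (1 + \<delta>) * r i t powr \<delta>)"
    proof (intro sum.cong refl)
      fix i assume "i \<in> I"
      have "r i t powr \<delta> / r i t = r i t powr (-\<theta>)"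
        using rp[OF \<open>i \<in> I\<close>] powr_diff[of "r i t" \<delta> 1] by (simp add: \<delta>_def)
      then show "r i t powr \<delta> * (\<delta> * C i / r i t - \<delta> - 1) = \<delta> * (C i * r i t powr (-\<theta>)) - (1 + \<delta>) * r i t powr \<delta>"
        by (simp add: algebra_simps) (metis times_divide_eq_right mult.left_commute)
    qed
    also have "\<dots> = \<delta> * T - (1 + \<delta>) * (\<Sum>i\<in>I. r i t powr \<delta>)"
      by (simp add: T_def sum_subtractf sum_distrib_left)
    finally have sum_eq: "(\<Sum>i\<in>I. r i t powr \<delta> * (\<delta> * C i / r i t - \<delta> - 1)) = \<delta> * T - (1 + \<delta>) * (\<Sum>i\<in>I. r i t powr \<delta>)" .
    obtain c where so: "second_order_at (Psi \<theta> \<eta>) t c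
        (4 * A t * ((real (card I) * \<theta> - 2) + \<eta> * \<delta> * (\<Sum>i\<in>I. r i t powr \<delta> * (\<delta> * C i / r i t - \<delta> - 1))))"
      using second_order_Psi[OF W, of \<theta> \<eta>] f unfolding \<delta>_def by blast
    have "\<eta> * \<delta> * (1 + \<delta>) * (\<Sum>i\<in>I. r i t powr \<delta>) \<le> \<eta> * \<delta> * (1 + \<delta>) * S"
      using rS eta d by (intro mult_left_mono) auto
    then have low: "\<eta> * \<delta>^2 * T \<le> (real (card I) * \<theta> - 2) + \<eta> * \<delta> * (\<delta> * T - (1 + \<delta>) * (\<Sum>i\<in>I. r i t powr \<delta>))"
      unfolding eta_eq by (simp add: algebra_simps power2_eq_square)
    have "\<exists>k\<in>I. (\<Prod>i\<in>I. r i t powr (-\<theta>)) \<le> (\<kappa> powr (-\<theta>)) ^ (card I - 1) * r k t powr (-\<theta>)"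
      by (rule prod_powr_le_one_factor[OF finite_I ne rp \<kappa>(1) th(1)]) (use \<kappa>(2) in simp_all)
    then obtain k where k: "k \<in> I" "(\<Prod>i\<in>I. r i t powr (-\<theta>)) \<le> (\<kappa> powr (-\<theta>)) ^ (card I - 1) * r k t powr (-\<theta>)"
      by blast
    have "Cm * r k t powr (-\<theta>) \<le> C k * r k t powr (-\<theta>)"
      using Cm(2)[OF k(1)] by (intro mult_right_mono) auto
    also have "\<dots> \<le> T"
      unfolding T_def using k(1) by (intro member_le_sum finite_I) (auto simp: C_def)
    finally have kT: "Cm * r k t powr (-\<theta>) \<le> T" .
    have "exp (Psi \<theta> \<eta> t) = A t * (\<Prod>i\<in>I. r i t powr (-\<theta>)) * exp (\<eta> * (\<Sum>i\<in>I. r i t powr \<delta>))"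
      using exp_Psi[OF W, of \<theta> \<eta>] f by (simp add: \<delta>_def)
    also have "\<dots> \<le> A t * ((\<kappa> powr (-\<theta>)) ^ (card I - 1) * r k t powr (-\<theta>)) * exp (\<eta> * S)"
      using k(2) rS eta A0 by (intro mult_mono mult_left_mono) (auto intro!: mult_nonneg_nonneg prod_nonneg)
    also have "\<dots> = B * (A t * r k t powr (-\<theta>))" by (simp add: B_def)
    finally have "K * exp (Psi \<theta> \<eta> t) \<le> K * (B * (A t * r k t powr (-\<theta>)))"
      using \<open>K > 0\<close> by simp
    also have "\<dots> = 4 * A t * (\<eta> * \<delta>^2 * (Cm * r k t powr (-\<theta>)))"
      using B by (simp add: K_def)
    also have "\<dots> \<le> 4 * A t * (\<eta> * \<delta>^2 * T)"
      using kT A0 eta by (intro mult_left_mono) auto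
    also have "\<dots> \<le> 4 * A t * ((real (card I) * \<theta> - 2) + \<eta> * \<delta> * (\<delta> * T - (1 + \<delta>) * (\<Sum>i\<in>I. r i t powr \<delta>)))"
      using low A0 by (intro mult_left_mono) auto
    finally show ?thesis using so unfolding sum_eq by blast
  qed
  ultimately show ?thesis using eta by blast
qed

section \<open>Orders of vanishing at the cone points\<close>

definition F :: "complex \<Rightarrow> complex" where "F z = (\<Prod>i\<in>I. f i z)"

lemma F_holomorphic: "F holomorphic_on UNIV"
  unfolding F_def[abs_def] by (intro holomorphic_intros lf_holomorphic)

lemma W_holomorphic: "W holomorphic_on UNIV"
  unfolding W_def by (intro holomorphic_intros hol)

lemma wronskian_lf:
  "(a i * b j - a j * b i) * W z = f i z * deriv (f j) z - f j z * deriv (f i) z"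
proof -
  have "deriv (f i) z = a i * deriv p z + b i * deriv q z" for i
    unfolding lf_def[abs_def] by (rule deriv_linear_combination[OF hol])
  then show ?thesis by (simp add: lf_def W_def wronskian_def algebra_simps)
qed

text \<open>
  At most one of the forms vanishes at \<open>t\<close>, so \<open>F\<close> and \<open>W\<close> are, up to units, a form and its
  Wronskian with a form that does not vanish there.  For \<open>e = 0\<close> the exponent \<open>e - 1\<close> is truncated.
\<close>

lemma F_W_order:
  assumes card: "card I \<ge> 2" and W: "W t0 \<noteq> 0"
  shows "\<exists>e g w r. r > 0 \<and> g holomorphic_on ball t r \<and> w holomorphic_on ball t r \<and> g t \<noteq> 0 \<and>
    (\<forall>z\<in>ball t r. F z = (z - t) ^ e * g z \<and> W z = (z - t) ^ (e - 1) * w z)"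
proof (cases "\<exists>k\<in>I. f k t = 0")
  case False
  then have "F t \<noteq> 0" by (simp add: F_def finite_I)
  then show ?thesis
    by (intro exI[of _ 0] exI[of _ F] exI[of _ W] exI[of _ 1])
       (auto intro: holomorphic_on_subset[OF F_holomorphic] holomorphic_on_subset[OF W_holomorphic])
next
  case True
  then obtain k where k: "k \<in> I" "f k t = 0" by blast
  have "\<not> I \<subseteq> {k}"
    using card card_mono[of "{k}" I] by auto
  then obtain j where j: "j \<in> I" "k \<noteq> j" by blast
  define D where "D = a k * b j - a j * b k"
  have D: "D \<noteq> 0" using indep[OF k(1) j] by (simp add: D_def)
  have WD: "D * W z = f k z * deriv (f j) z - f j z * deriv (f k) z" for z
    unfolding D_def by (rule wronskian_lf)
  have nonzero: "f i t \<noteq> 0" if "i \<in> I" "i \<noteq> k" for i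
  proof
    assume i: "f i t = 0"
    have "(a k * b i - a i * b k) * p t = 0" "(a k * b i - a i * b k) * q t = 0"
      using i k(2) unfolding lf_def by algebra+
    then show False using no_common_zero[of t] indep[OF k(1) that(1)] that(2) by auto
  qed
  \<comment> \<open>As \<open>f k t = 0\<close>, a constant \<open>f k\<close> would be zero, and
    \<open>W\<close> would then vanish identically.\<close>
  have "\<not> f k constant_on UNIV"
  proof
    assume "f k constant_on UNIV"
    then have z: "f k = (\<lambda>z. 0)" using k(2) unfolding constant_on_def by force
    have "D * W t0 = 0" unfolding WD z by simp
    then show False using D W by simp
  qed
  then obtain h r n where n: "0 < n" and r: "0 < r" and h: "h holomorphic_on ball t r"
    and fh: "\<And>z. z \<in> ball t r \<Longrightarrow> f k z = (z - t) ^ n * h z" and h0: "\<And>z. z \<in> ball t r \<Longrightarrow> h z \<noteq> 0"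
    using holomorphic_factor_zero_nonconstant[OF lf_holomorphic open_UNIV connected_UNIV UNIV_I k(2)] by metis
  define g where "g = (\<lambda>z. h z * (\<Prod>i\<in>I - {k}. f i z))"
  \<comment> \<open>The Wronskian of \<open>f k = (z - t)^n * h\<close> with \<open>f j\<close>,
    after division by \<open>(z - t)^(n - 1)\<close> and by the determinant \<open>D\<close>
    relating it to \<open>W\<close>.\<close>
  define w where "w = (\<lambda>z. ((z - t) * h z * deriv (f j) z - f j z * (of_nat n * h z + (z - t) * deriv h z)) / D)"
  have fb: "f i holomorphic_on ball t r" for i by (rule holomorphic_on_subset[OF lf_holomorphic]) auto
  have "g holomorphic_on ball t r" unfolding g_def by (intro holomorphic_intros h fb)
  moreover have "w holomorphic_on ball t r" unfolding w_def by (intro holomorphic_intros h fb open_ball) (use D in auto)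
  moreover have "g t \<noteq> 0" using h0[of t] r nonzero finite_I by (auto simp: g_def)
  moreover have "F z = (z - t) ^ n * g z" if "z \<in> ball t r" for z
    unfolding F_def g_def prod.remove[OF finite_I k(1)] fh[OF that] by simp
  moreover have "W z = (z - t) ^ (n - 1) * w z" if z: "z \<in> ball t r" for z
  proof -
    have "deriv (f k) z = deriv (\<lambda>z. (z - t) ^ n * h z) z"
      using z fh by (intro deriv_cong_ev) (auto intro!: eventually_nhds_in_open[THEN eventually_mono, of "ball t r"])
    also have "\<dots> = of_nat n * (z - t) ^ (n - 1) * h z + (z - t) ^ n * deriv h z"
      using holomorphic_derivI[OF h open_ball z]
      by (auto intro!: DERIV_imp_deriv derivative_eq_intros)
    finally have dk: "deriv (f k) z = of_nat n * (z - t) ^ (n - 1) * h z + (z - t) ^ n * deriv h z" .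
    have pn: "(z - t) ^ n = (z - t) ^ (n - 1) * (z - t)" using n by (simp add: power_eq_if mult.commute)
    have Dw: "D * w z = (z - t) * h z * deriv (f j) z - f j z * (of_nat n * h z + (z - t) * deriv h z)"
      using D by (simp add: w_def)
    have "D * W z = (z - t) ^ (n - 1) * (D * w z)"
      unfolding WD dk fh[OF z] pn Dw by (simp add: algebra_simps)
    then show ?thesis using D by simp
  qed
  ultimately show ?thesis using r by blast
qed

text \<open>The part of \<open>Psi\<close> that stays finite at the zeros of \<open>W\<close> and of
  the forms; it is separated so that continuity there depends only on orders of vanishing.\<close>

definition E :: "real \<Rightarrow> real \<Rightarrow> complex \<Rightarrow> real" where
  "E \<theta> \<eta> z = (real (card I) * \<theta> - 2) * ln (N z) + \<eta> * (\<Sum>i\<in>I. r i z powr (1 - \<theta>))"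

lemma continuous_E:
  assumes "\<theta> < 1"
  shows "continuous_on UNIV (E \<theta> \<eta>)"
proof -
  have c: "continuous_on UNIV p" "continuous_on UNIV q" "\<And>i. continuous_on UNIV (f i)"
    using hol lf_holomorphic holomorphic_on_imp_continuous_on by blast+
  have N: "continuous_on UNIV N" unfolding N_def[abs_def] by (intro continuous_intros c)
  have "N z \<noteq> 0" for z using N_pos[of z] by simp
  then have r: "continuous_on UNIV (r i)" for i
    unfolding rat_def[abs_def] by (intro continuous_intros c N) auto
  show ?thesis
    unfolding E_def[abs_def] using N_pos assms \<open>\<And>z. N z \<noteq> 0\<close> 
    by (intro continuous_intros N continuous_on_powr' r) (auto simp: r_nonneg)
qed

lemma Psi_eq:
  assumes "W z \<noteq> 0" "F z \<noteq> 0"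
  shows "Psi \<theta> \<eta> z = 2 * ln (cmod (W z)) - 2 * \<theta> * ln (cmod (F z)) + E \<theta> \<eta> z"
proof -
  have f: "f i z \<noteq> 0" if "i \<in> I" for i using assms(2) that by (auto simp: F_def finite_I)
  have "cmod (F z) = (\<Prod>i\<in>I. cmod (f i z))" by (simp add: F_def prod_norm)
  then have "ln (cmod (F z)) = (\<Sum>i\<in>I. ln (cmod (f i z)))"
    using f by (simp add: ln_prod finite_I)
  moreover have "(\<Sum>i\<in>I. ln ((cmod (f i z))^2)) = (\<Sum>i\<in>I. 2 * ln (cmod (f i z)))"
    using f by (intro sum.cong refl) (simp add: ln_realpow)
  moreover have "exp ((1 - \<theta>) * (ln ((cmod (f i z))^2) - ln (N z))) = r i z powr (1 - \<theta>)" if "i \<in> I" for i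
    using f[OF that] N_pos[of z] by (simp add: powr_def rat_def ln_div)
  ultimately show ?thesis
    using assms(1) by (simp add: Psi_def E_def ln_realpow sum_distrib_left[symmetric])
qed

end

section \<open>The geometric mean of two cone metrics\<close>

text \<open>If \<open>m > e\<close>, cancelling \<open>(z - t)^e\<close> away from \<open>t\<close>
  and passing to the limit would give \<open>g t = 0\<close>.\<close>

lemma power_order_le:
  assumes g: "g holomorphic_on ball t r" "g t \<noteq> 0" "r > 0"
    and v: "v holomorphic_on ball t r"
    and eq: "\<And>z. z \<in> ball t r \<Longrightarrow> (z - t) ^ e * g z = (z - t) ^ m * v z"
  shows "m \<le> e"
proof (rule ccontr)
  assume "\<not> m \<le> e"
  have cont: "continuous (at t) g" "continuous (at t) v"
    using g v holomorphic_on_imp_continuous_on continuous_on_eq_continuous_at[OF open_ball]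
    by (metis centre_in_ball)+
  then have lim: "(g \<longlongrightarrow> g t) (at t)" "((\<lambda>z. (z - t) ^ (m - e) * v z) \<longlongrightarrow> (t - t) ^ (m - e) * v t) (at t)"
    unfolding isCont_def by - (assumption, intro tendsto_intros)
  have "\<forall>\<^sub>F z in at t. (z - t) ^ (m - e) * v z = g z"
    unfolding eventually_at
  proof (intro exI[of _ r] conjI ballI impI)
    fix z assume z: "z \<noteq> t \<and> dist z t < r"
    have "(z - t) ^ m = (z - t) ^ e * (z - t) ^ (m - e)"
      using \<open>\<not> m \<le> e\<close> by (simp flip: power_add)
    then show "(z - t) ^ (m - e) * v z = g z"
      using eq[of z] z by (auto simp: dist_commute)
  qed fact
  with lim(2) have "(g \<longlongrightarrow> (t - t) ^ (m - e) * v t) (at t)"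
    by (rule Lim_transform_eventually)
  then have "g t = (t - t) ^ (m - e) * v t" using lim(1) LIM_unique by blast
  then show False using g(2) \<open>\<not> m \<le> e\<close> by simp
qed

text \<open>Off its zeros \<open>G\<close> is the exponential of the average of the two functions
  \<open>Psi\<close>, so its curvature bound is the average of theirs. \<open>M\<close> need not be
  the degree of one cover: the case of a single curve uses a doubled exponent.\<close>

lemma vanishing_wronskian:
  fixes I :: "'i set" and J :: "'j set" and \<theta> :: real
  assumes P: "curve_and_lines p1 p2 I a b" and Q: "curve_and_lines q1 q2 J c d"
    and th: "0 < \<theta>" "\<theta> < 1" and cards: "real (card I) * \<theta> > 2" "real (card J) * \<theta> > 2"
    and M: "real M * (1 - \<theta>) > 2"
    and Z: "Z holomorphic_on UNIV" and u: "u holomorphic_on UNIV"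
    and eq: "\<And>z. (\<Prod>i\<in>I. a i * p1 z + b i * p2 z) * (\<Prod>j\<in>J. c j * q1 z + d j * q2 z) = u z * Z z ^ M"
    and u0: "\<And>z. u z \<noteq> 0"
  shows "(\<forall>z. wronskian p1 p2 z = 0) \<or> (\<forall>z. wronskian q1 q2 z = 0)"
proof (rule ccontr)
  interpret P: curve_and_lines p1 p2 I a b by (rule P)
  interpret Q: curve_and_lines q1 q2 J c d by (rule Q)
  assume "\<not> ?thesis"
  then obtain s1 s2 where s1: "P.W s1 \<noteq> 0" and s2: "Q.W s2 \<noteq> 0"
    unfolding P.W_def Q.W_def by auto
  have card2: "card X \<ge> 2" if "real (card X) * \<theta> > 2" for X :: "'x set"
  proof (rule ccontr)
    assume "\<not> card X \<ge> 2"
    then have "real (card X) * \<theta> \<le> 1 * 1" using th by (intro mult_mono) auto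
    then show False using that by simp
  qed
  define H where "H = (\<lambda>z. P.F z * Q.F z)"
  define V where "V = (\<lambda>z. P.W z * Q.W z)"
  have H_eq: "H z = u z * Z z ^ M" for z
    using eq[of z] by (simp add: H_def P.F_def Q.F_def P.lf_def Q.lf_def)
  have holH: "H holomorphic_on UNIV" unfolding H_def by (intro holomorphic_intros P.F_holomorphic Q.F_holomorphic)
  have holV: "V holomorphic_on UNIV" unfolding V_def by (intro holomorphic_intros P.W_holomorphic Q.W_holomorphic)
  have M0: "M > 0" using M by (cases M) auto
  have order: "\<exists>e k g w r. r > 0 \<and> g holomorphic_on ball t r \<and> w holomorphic_on ball t r \<and> g t \<noteq> 0 \<and> e \<le> k + 2 \<and>
    (\<forall>z\<in>ball t r. H z = (z - t) ^ e * g z \<and> V z = (z - t) ^ k * w z)" for t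
  proof -
    obtain e1 g1 w1 r1 where 1: "r1 > 0" "g1 holomorphic_on ball t r1" "w1 holomorphic_on ball t r1" "g1 t \<noteq> 0"
      "\<And>z. z\<in>ball t r1 \<Longrightarrow> P.F z = (z - t) ^ e1 * g1 z \<and> P.W z = (z - t) ^ (e1 - 1) * w1 z"
      using P.F_W_order[OF card2[OF cards(1)] s1] by blast
    obtain e2 g2 w2 r2 where 2: "r2 > 0" "g2 holomorphic_on ball t r2" "w2 holomorphic_on ball t r2" "g2 t \<noteq> 0"
      "\<And>z. z\<in>ball t r2 \<Longrightarrow> Q.F z = (z - t) ^ e2 * g2 z \<and> Q.W z = (z - t) ^ (e2 - 1) * w2 z"
      using Q.F_W_order[OF card2[OF cards(2)] s2] by blast
    define r where "r = min r1 r2"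
    have sub: "ball t r \<subseteq> ball t r1" "ball t r \<subseteq> ball t r2" by (auto simp: r_def)
    show ?thesis
    proof (rule exI[of _ "e1 + e2"], rule exI[of _ "(e1 - 1) + (e2 - 1)"], rule exI[of _ "\<lambda>z. g1 z * g2 z"],
        rule exI[of _ "\<lambda>z. w1 z * w2 z"], rule exI[of _ r], intro conjI ballI)
      show "r > 0" using 1 2 by (simp add: r_def)
      show "(\<lambda>z. g1 z * g2 z) holomorphic_on ball t r"
        by (intro holomorphic_intros holomorphic_on_subset[OF 1(2) sub(1)] holomorphic_on_subset[OF 2(2) sub(2)])
      show "(\<lambda>z. w1 z * w2 z) holomorphic_on ball t r"
        by (intro holomorphic_intros holomorphic_on_subset[OF 1(3) sub(1)] holomorphic_on_subset[OF 2(3) sub(2)])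
      show "g1 t * g2 t \<noteq> 0" using 1 2 by simp
      \<comment> \<open>The truncated subtraction loses at most one for each curve.\<close>
      show "e1 + e2 \<le> e1 - 1 + (e2 - 1) + 2" by simp
      fix z assume "z \<in> ball t r"
      then have z: "z \<in> ball t r1" "z \<in> ball t r2" using sub by auto
      show "H z = (z - t) ^ (e1 + e2) * (g1 z * g2 z)" using 1(5)[OF z(1)] 2(5)[OF z(2)] by (simp add: H_def power_add)
      show "V z = (z - t) ^ (e1 - 1 + (e2 - 1)) * (w1 z * w2 z)" using 1(5)[OF z(1)] 2(5)[OF z(2)] by (simp add: V_def power_add)
    qed
  qed
  obtain \<eta>1 K1 where K1: "K1 > 0" "\<And>t. P.W t \<noteq> 0 \<Longrightarrow> (\<forall>i\<in>I. P.f i t \<noteq> 0) \<Longrightarrow>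
           (\<exists>c L. second_order_at (P.Psi \<theta> \<eta>1) t c L \<and> L \<ge> K1 * exp (P.Psi \<theta> \<eta>1 t))"
    using P.curvature[OF th cards(1)] by blast
  obtain \<eta>2 K2 where K2: "K2 > 0" "\<And>t. Q.W t \<noteq> 0 \<Longrightarrow> (\<forall>j\<in>J. Q.f j t \<noteq> 0) \<Longrightarrow>
           (\<exists>c L. second_order_at (Q.Psi \<theta> \<eta>2) t c L \<and> L \<ge> K2 * exp (Q.Psi \<theta> \<eta>2 t))"
    using Q.curvature[OF th cards(2)] by blast
  define Ex where "Ex = (\<lambda>z. exp ((P.E \<theta> \<eta>1 z + Q.E \<theta> \<eta>2 z) / 2))"
  \<comment> \<open>\<open>0 powr (-\<theta>) = 0\<close>, so \<open>G\<close> vanishes at the zeros of \<open>H\<close>, as its continuity there requires.\<close>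
  define G where "G = (\<lambda>z. cmod (V z) * cmod (H z) powr (-\<theta>) * Ex z)"
  have contEx: "continuous_on UNIV Ex"
    unfolding Ex_def by (intro continuous_intros P.continuous_E Q.continuous_E th) auto
  have contH: "isCont H t" and contV: "isCont V t" for t
    using holomorphic_on_imp_continuous_on[OF holH] holomorphic_on_imp_continuous_on[OF holV]
    by (auto simp: continuous_on_eq_continuous_at)
  have contE: "isCont Ex t" for t using contEx by (auto simp: continuous_on_eq_continuous_at)
  have contG: "isCont G t" for t
  proof (cases "H t = 0")
    case False
    then show ?thesis
      unfolding G_def by (intro continuous_intros contH contV contE) auto
  next
    case True
    obtain e k g w r where o: "r > 0" "g holomorphic_on ball t r" "w holomorphic_on ball t r" "g t \<noteq> 0" "e \<le> k + 2"
      "\<And>z. z\<in>ball t r \<Longrightarrow> H z = (z - t) ^ e * g z \<and> V z = (z - t) ^ k * w z"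
      using order[of t] by blast
    have "Z t = 0" using True H_eq[of t] u0[of t] by (simp add: M0)
    \<comment> \<open>\<open>Z\<close> vanishes at \<open>t\<close> because \<open>u\<close> does
      not, so one factor \<open>z - t\<close> splits off \<open>Z\<close>, hence \<open>M\<close> of
      them off \<open>H\<close>.\<close>
    define z1 where "z1 = (\<lambda>z. if z = t then deriv Z t else (Z z - Z t) / (z - t))"
    have holz1: "z1 holomorphic_on UNIV" unfolding z1_def by (rule pole_lemma_open[OF Z open_UNIV])
    have Zz1: "Z z = (z - t) * z1 z" for z using \<open>Z t = 0\<close> by (simp add: z1_def)
    have "M \<le> e"
    proof (rule power_order_le[OF o(2,4,1)])
      show "(\<lambda>z. u z * z1 z ^ M) holomorphic_on ball t r"
        by (intro holomorphic_intros holomorphic_on_subset[OF u] holomorphic_on_subset[OF holz1]) auto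
      show "(z - t) ^ e * g z = (z - t) ^ M * (u z * z1 z ^ M)" if "z \<in> ball t r" for z
        using o(6)[OF that] H_eq[of z] Zz1[of z] by (simp add: power_mult_distrib mult_ac)
    qed
    define \<epsilon> where "\<epsilon> = real k - \<theta> * real e"
    have "\<epsilon> > 0"
    proof -
      have "real M * (1 - \<theta>) \<le> real e * (1 - \<theta>)" using \<open>M \<le> e\<close> th by (intro mult_right_mono) auto
      then have "2 < real e - \<theta> * real e" using M by (simp add: algebra_simps)
      moreover have "real e \<le> real k + 2" using o(5) by simp
      ultimately show ?thesis by (simp add: \<epsilon>_def)
    qed
    have cg: "isCont g t" "isCont w t"
      using o(1-3) holomorphic_on_imp_continuous_on continuous_on_eq_continuous_at[OF open_ball]
      by (metis centre_in_ball)+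
    have "((\<lambda>z. cmod (z - t) powr \<epsilon> * (cmod (w z) * cmod (g z) powr (-\<theta>) * Ex z)) \<longlongrightarrow> 0 * (cmod (w t) * cmod (g t) powr (-\<theta>) * Ex t)) (at t)"
    proof (intro tendsto_mult)
      have "((\<lambda>z. cmod (z - t)) \<longlongrightarrow> 0) (at t)"
        by (rule tendsto_eq_intros refl | simp)+
      then show "((\<lambda>z. cmod (z - t) powr \<epsilon>) \<longlongrightarrow> 0) (at t)"
        by (rule tendsto_zero_powrI[OF _ tendsto_const]) (use \<open>\<epsilon> > 0\<close> in auto)
      show "((\<lambda>z. cmod (g z) powr - \<theta>) \<longlongrightarrow> cmod (g t) powr - \<theta>) (at t)"
        using cg o(4) by (intro tendsto_powr tendsto_norm) (auto simp: isCont_def)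
      show "((\<lambda>z. cmod (w z)) \<longlongrightarrow> cmod (w t)) (at t)" "(Ex \<longlongrightarrow> Ex t) (at t)"
        using cg contE[of t] by (auto simp: isCont_def intro: tendsto_norm)
    qed
    moreover have "\<forall>\<^sub>F z in at t. cmod (z - t) powr \<epsilon> * (cmod (w z) * cmod (g z) powr (-\<theta>) * Ex z) = G z"
      unfolding eventually_at
    proof (intro exI[of _ r] conjI ballI impI)
      fix z assume z: "z \<noteq> t \<and> dist z t < r"
      then have zt: "cmod (z - t) > 0" and "z \<in> ball t r" by (auto simp: dist_commute)
      have "cmod (z - t) ^ k * (cmod (z - t) ^ e) powr (-\<theta>) = cmod (z - t) powr \<epsilon>"
        using zt by (simp add: \<epsilon>_def powr_powr powr_add[symmetric] powr_realpow[symmetric] mult.commute)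
      then show "cmod (z - t) powr \<epsilon> * (cmod (w z) * cmod (g z) powr (-\<theta>) * Ex z) = G z"
        using o(6)[OF \<open>z \<in> ball t r\<close>] by (simp add: G_def norm_mult norm_power powr_mult mult_ac)
    qed (rule o(1))
    ultimately have "(G \<longlongrightarrow> 0) (at t)" by (simp add: Lim_transform_eventually)
    moreover have "G t = 0" using True by (simp add: G_def)
    ultimately show ?thesis by (simp add: isCont_def)
  qed
  have cG: "continuous_on UNIV G" using contG by (simp add: continuous_at_imp_continuous_on)
  have Gnn: "G z \<ge> 0" for z by (simp add: G_def Ex_def)
  define K where "K = min K1 K2"
  have "K > 0" using K1(1) K2(1) by (simp add: K_def)
  have nz: "P.W z \<noteq> 0 \<and> Q.W z \<noteq> 0 \<and> P.F z \<noteq> 0 \<and> Q.F z \<noteq> 0" if "G z > 0" for z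
    using that by (auto simp: G_def V_def H_def)
  have lnG: "ln (G z) = (1/2) * (P.Psi \<theta> \<eta>1 z + Q.Psi \<theta> \<eta>2 z)" if "G z > 0" for z
  proof -
    note n = nz[OF that]
    have "ln (G z) = ln (cmod (P.W z)) + ln (cmod (Q.W z)) - \<theta> * (ln (cmod (P.F z)) + ln (cmod (Q.F z))) + (P.E \<theta> \<eta>1 z + Q.E \<theta> \<eta>2 z) / 2"
      using n by (simp add: G_def V_def H_def Ex_def norm_mult ln_mult ln_powr)
    then show ?thesis using n by (simp add: P.Psi_eq Q.Psi_eq algebra_simps)
  qed
  have "G s = 0" for s
  proof (rule ahlfors_schwarz_vanishing[OF cG Gnn \<open>K > 0\<close>])
    fix t assume Gt: "G t > 0"
    note n = nz[OF Gt]
    obtain c1 L1 where 1: "second_order_at (P.Psi \<theta> \<eta>1) t c1 L1" "L1 \<ge> K1 * exp (P.Psi \<theta> \<eta>1 t)"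
      using K1(2)[of t] n by (auto simp: P.F_def P.finite_I)
    obtain c2 L2 where 2: "second_order_at (Q.Psi \<theta> \<eta>2) t c2 L2" "L2 \<ge> K2 * exp (Q.Psi \<theta> \<eta>2 t)"
      using K2(2)[of t] n by (auto simp: Q.F_def Q.finite_I)
    have "second_order_at (\<lambda>z. (1/2) * (P.Psi \<theta> \<eta>1 z + Q.Psi \<theta> \<eta>2 z)) t (of_real (1/2) * (c1 + c2)) ((1/2) * (L1 + L2))"
      by (intro second_order_at_cmult second_order_at_add 1 2)
    moreover have "\<forall>\<^sub>F z in nhds t. (1/2) * (P.Psi \<theta> \<eta>1 z + Q.Psi \<theta> \<eta>2 z) = ln (G z)"
    proof -
      have "open {z. G z > 0}" using cG by (intro open_Collect_less) (auto intro: continuous_intros)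
      then have "\<forall>\<^sub>F z in nhds t. z \<in> {z. G z > 0}" using Gt by (intro eventually_nhds_in_open) auto
      then show ?thesis by eventually_elim (simp add: lnG)
    qed
    ultimately have "second_order_at (\<lambda>z. ln (G z)) t (of_real (1/2) * (c1 + c2)) ((1/2) * (L1 + L2))"
      by (rule second_order_at_cong)
    moreover have "K * G t \<le> (1/2) * (L1 + L2)"
    proof -
      define x where "x = exp (P.Psi \<theta> \<eta>1 t / 2)"
      define y where "y = exp (Q.Psi \<theta> \<eta>2 t / 2)"
      have "G t = exp (ln (G t))" using Gt by simp
      also have "\<dots> = x * y" unfolding lnG[OF Gt] x_def y_def by (simp add: add_divide_distrib flip: exp_add)
      finally have Gxy: "G t = x * y" .
      have x2: "exp (P.Psi \<theta> \<eta>1 t) = x^2" "exp (Q.Psi \<theta> \<eta>2 t) = y^2"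
        unfolding x_def y_def by (simp_all flip: exp_of_nat_mult)
      \<comment> \<open>The inequality between arithmetic and geometric means: the curvature
        estimates bound \<open>x^2\<close> and \<open>y^2\<close> separately, while
        \<open>G t = x * y\<close>.\<close>
      have "2 * (x * y) \<le> x^2 + y^2" using sum_squares_bound[of x y] by (simp add: mult.assoc)
      then have "K * (2 * (x * y)) \<le> K * x^2 + K * y^2"
        using \<open>K > 0\<close> by (simp flip: distrib_left)
      also have "\<dots> \<le> K1 * x^2 + K2 * y^2" by (intro add_mono mult_right_mono) (auto simp: K_def)
      also have "\<dots> \<le> L1 + L2" using 1(2) 2(2) unfolding x2 by simp
      finally show ?thesis by (simp add: Gxy)
    qed
    ultimately show "\<exists>c L. second_order_at (\<lambda>z. ln (G z)) t c L \<and> K * G t \<le> L" by blast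
  qed
  then have "V z * H z = 0" for z by (auto simp: G_def Ex_def)
  then have *: "(\<lambda>z. P.W z * Q.W z * (P.F z * Q.F z)) = (\<lambda>z. 0)" by (auto simp: V_def H_def)
  \<comment> \<open>\<open>V * H\<close> vanishes identically, yet near \<open>s1\<close>, off
    \<open>s1\<close> itself, all its factors are nonzero: the two Wronskians by the identity
    theorem, \<open>H\<close> by its local factorization.\<close>
  obtain e g w r where o: "r > 0" "g holomorphic_on ball s1 r" "g s1 \<noteq> 0"
      "\<And>z. z\<in>ball s1 r \<Longrightarrow> H z = (z - s1) ^ e * g z"
    using order[of s1] by blast
  have W1: "\<forall>\<^sub>F z in at s1. P.W z \<noteq> 0"
    by (rule non_zero_neighbour_alt[OF P.W_holomorphic open_UNIV connected_UNIV UNIV_I, of s1 s1, THEN eventually_mono]) (use s1 in auto)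
  have W2: "\<forall>\<^sub>F z in at s1. Q.W z \<noteq> 0"
    by (rule non_zero_neighbour_alt[OF Q.W_holomorphic open_UNIV connected_UNIV UNIV_I, of s2 s1, THEN eventually_mono]) (use s2 in auto)
  have "isCont g s1"
    using o(1,2) holomorphic_on_imp_continuous_on continuous_on_eq_continuous_at[OF open_ball]
    by (metis centre_in_ball)
  then have "\<forall>\<^sub>F z in at s1. g z \<noteq> 0"
    using o(3) unfolding isCont_def by (rule tendsto_imp_eventually_ne)
  moreover have "\<forall>\<^sub>F z in at s1. z \<in> ball s1 r - {s1}"
    using o(1) by (intro eventually_at_in_open) auto
  ultimately have "\<forall>\<^sub>F z in at s1. False"
    using W1 W2
  proof eventually_elim
    case (elim z)
    then show ?case using \<open>\<And>z. V z * H z = 0\<close>[of z] o(4)[of z] by (auto simp: V_def)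
  qed
  then show False by simp
qed

section \<open>Curves in the projective line\<close>

lemma reps_scale:
  assumes "v \<in> reps p"
  shows "reps p = {c *s v | c. c \<noteq> 0}"
proof -
  obtain u where u: "u \<noteq> 0" "Rep_p1 p = vec.span {u}"
    using Rep_p1[of p] by blast
  obtain k where k: "v = k *s u" "v \<noteq> 0"
    using assms u unfolding reps_def vec.span_singleton by auto
  then have "k \<noteq> 0" by auto
  then have "u = inverse k *s v" by (simp add: k vector_smult_assoc)
  have "Rep_p1 p = range (\<lambda>c. c *s v)"
  proof safe
    fix x assume "x \<in> Rep_p1 p"
    then obtain c where "x = c *s u" unfolding u vec.span_singleton by auto
    then have "x = (c * inverse k) *s v" by (simp add: \<open>u = inverse k *s v\<close> vector_smult_assoc)
    then show "x \<in> range (\<lambda>c. c *s v)" by blast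
  next
    fix c show "c *s v \<in> Rep_p1 p" unfolding u vec.span_singleton k(1) vector_smult_assoc by (rule rangeI)
  qed
  then show ?thesis using k(2) unfolding reps_def by (auto simp: vector_mul_eq_0)
qed

lemma reps_nonzero: "v \<in> reps p \<Longrightarrow> v \<noteq> 0"
  by (simp add: reps_def)

lemma hcoord_in_reps: "hcoord p \<in> reps p"
proof -
  obtain u where u: "u \<noteq> 0" "Rep_p1 p = vec.span {u}"
    using Rep_p1[of p] by blast
  then have "u \<in> reps p" by (simp add: reps_def vec.span_base)
  then show ?thesis unfolding hcoord_def by (rule someI)
qed

lemma p1_eqI:
  assumes "v \<in> reps p" "v \<in> reps p'"
  shows "p = p'"
proof -
  have "0 \<in> Rep_p1 p" for p
    using Rep_p1[of p] vec.span_zero by auto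
  then have "Rep_p1 p = insert 0 (reps p)" for p by (auto simp: reps_def)
  moreover have "reps p = reps p'" using reps_scale[OF assms(1)] reps_scale[OF assms(2)] by simp
  ultimately show ?thesis by (simp add: Rep_p1_inject[symmetric])
qed

lemma ex_reps:
  assumes "v \<noteq> 0"
  shows "\<exists>p. v \<in> reps p"
proof -
  have "Rep_p1 (Abs_p1 (vec.span {v})) = vec.span {v}"
    using assms by (intro Abs_p1_inverse) auto
  then show ?thesis using assms by (intro exI[of _ "Abs_p1 (vec.span {v})"]) (simp add: reps_def vec.span_base)
qed

lemma vec2_eq_iff: "(v :: complex ^ 2) = w \<longleftrightarrow> v $ 1 = w $ 1 \<and> v $ 2 = w $ 2"
  by (simp add: vec_eq_iff forall_2)

lemma hcoord_nonzero: "hcoord p $ 1 \<noteq> 0 \<or> hcoord p $ 2 \<noteq> 0"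
  using reps_nonzero[OF hcoord_in_reps[of p]] by (auto simp: vec2_eq_iff)

lemma vector2_in_reps_iff:
  "vector [x, y] \<in> reps p \<longleftrightarrow> (\<exists>c. c \<noteq> 0 \<and> x = c * hcoord p $ 1 \<and> y = c * hcoord p $ 2)"
  unfolding reps_scale[OF hcoord_in_reps[of p]] by (auto simp: vec2_eq_iff)

text \<open>Only quotients are required to be holomorphic: \<open>hcoord\<close> is an arbitrary
  choice at each point and need not even be continuous along the curve.\<close>

definition p1_curve :: "(complex \<Rightarrow> p1) \<Rightarrow> bool" where
  "p1_curve p \<longleftrightarrow> (\<forall>i. open {t. hcoord (p t) $ i \<noteq> 0} \<and>
     (\<forall>a. (\<lambda>t. hcoord (p t) $ a / hcoord (p t) $ i) holomorphic_on {t. hcoord (p t) $ i \<noteq> 0}))"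

text \<open>The identity theorem for maps to the projective line. The interior \<open>S\<close> of
  the set where the first coordinate vanishes is closed: its limit points lie in the other chart,
  where the identity theorem on a ball applies. Connectedness and \<open>t0\<close> give
  \<open>S = {}\<close>.\<close>

lemma p1_curve_isolated:
  assumes p: "p1_curve p" and ne: "hcoord (p t0) $ 1 \<noteq> 0" and t: "hcoord (p t) $ 1 = 0"
  shows "\<forall>\<^sub>F z in at t. hcoord (p z) $ 1 / hcoord (p z) $ 2 \<noteq> 0 \<and> hcoord (p z) $ 2 \<noteq> 0"
proof -
  define U where "U = (\<lambda>i. {t. hcoord (p t) $ i \<noteq> 0})"
  define x where "x = (\<lambda>t. hcoord (p t) $ 1 / hcoord (p t) $ 2)"
  have op: "open (U i)" for i using p by (auto simp: p1_curve_def U_def)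
  have hx: "x holomorphic_on U 2" using p by (auto simp: p1_curve_def U_def x_def)
  have cover: "z \<in> U 1 \<or> z \<in> U 2" for z using hcoord_nonzero[of "p z"] by (auto simp: U_def)
  have x0: "x z = 0 \<longleftrightarrow> z \<notin> U 1" if "z \<in> U 2" for z using that by (auto simp: x_def U_def)
  define S where "S = interior (- U 1)"
  have ball_alt: "(\<forall>\<^sub>F z in at u. x z \<noteq> 0 \<and> z \<in> U 2) \<or> u \<in> S" if u: "u \<in> U 2" for u
  proof -
    obtain r where r: "r > 0" "ball u r \<subseteq> U 2" using op u openE by blast
    show ?thesis
    proof (cases "\<exists>w\<in>ball u r. x w \<noteq> 0")
      case True
      then obtain w where w: "w \<in> ball u r" "x w \<noteq> 0" by blast
      have "\<forall>\<^sub>F z in at u. x z \<noteq> 0 \<and> z \<in> ball u r"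
        by (rule non_zero_neighbour_alt[OF holomorphic_on_subset[OF hx r(2)]]) (use r w in auto)
      then have "\<forall>\<^sub>F z in at u. x z \<noteq> 0 \<and> z \<in> U 2" by eventually_elim (use r(2) in blast)
      then show ?thesis ..
    next
      case False
      then have "ball u r \<subseteq> - U 1" using x0 r by blast
      then have "u \<in> S" unfolding S_def using r(1) by (meson centre_in_ball interior_maximal open_ball subsetD)
      then show ?thesis ..
    qed
  qed
  have "closed S"
    unfolding closed_limpt
  proof (intro allI impI)
    fix u assume u: "u islimpt S"
    have "u \<notin> U 1"
    proof
      assume "u \<in> U 1"
      then obtain z where "z \<in> S" "z \<in> U 1" using u op islimptE by blast
      then show False using interior_subset[of "- U 1"] by (auto simp: S_def)
    qed
    then have "u \<in> U 2" using cover by blast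
    show "u \<in> S"
    proof (rule ccontr)
      assume "u \<notin> S"
      with ball_alt[OF \<open>u \<in> U 2\<close>] have "\<forall>\<^sub>F z in at u. x z \<noteq> 0 \<and> z \<in> U 2" by blast
      then have "\<forall>\<^sub>F z in at u. z \<notin> S"
        by eventually_elim (use x0 interior_subset[of "- U 1"] in \<open>auto simp: S_def\<close>)
      then show False using u by (auto simp: islimpt_iff_eventually)
    qed
  qed
  moreover have "open S" by (simp add: S_def)
  ultimately have "S = {} \<or> S = UNIV" using clopen by blast
  moreover have "t0 \<notin> S" using ne interior_subset[of "- U 1"] by (auto simp: S_def U_def)
  ultimately have "S = {}" by auto
  moreover have "t \<in> U 2" using cover[of t] t by (auto simp: U_def)
  ultimately show ?thesis using ball_alt[of t] by (auto simp: x_def U_def)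
qed

text \<open>Unless the curve sits at the point at infinity of \<open>g\<close>, \<open>g\<close> is
  meromorphic on the plane, and Weierstrass factorization writes it as a quotient of entire
  functions without common zeros. These are the homogeneous coordinates.\<close>

lemma p1_curve_lift:
  assumes p: "p1_curve p"
  shows "\<exists>P1 P2. P1 holomorphic_on UNIV \<and> P2 holomorphic_on UNIV \<and> (\<forall>t. vector [P1 t, P2 t] \<in> reps (p t))"
proof (cases "\<exists>t0. hcoord (p t0) $ 1 \<noteq> 0")
  case False
  have "vector [0, 1] \<in> reps (p t)" for t
    using False hcoord_nonzero[of "p t"] by (auto simp: vector2_in_reps_iff intro!: exI[of _ "inverse (hcoord (p t) $ 2)"])
  then show ?thesis by (intro exI[of _ "\<lambda>_. 0"] exI[of _ "\<lambda>_. 1"]) auto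
next
  case True
  then obtain t0 where t0: "hcoord (p t0) $ 1 \<noteq> 0" by blast
  define g where "g = (\<lambda>t. hcoord (p t) $ 2 / hcoord (p t) $ 1)"
  define x where "x = (\<lambda>t. hcoord (p t) $ 1 / hcoord (p t) $ 2)"
  define U where "U = (\<lambda>i. {t. hcoord (p t) $ i \<noteq> 0})"
  have op: "open (U i)" for i using p by (auto simp: p1_curve_def U_def)
  have hx: "x holomorphic_on U 2" using p by (auto simp: p1_curve_def U_def x_def)
  have hg: "g holomorphic_on U 1" using p by (auto simp: p1_curve_def U_def g_def)
  have gx: "g = (\<lambda>t. inverse (x t))" by (simp add: g_def x_def fun_eq_iff)
  have on1: "g analytic_on {t} \<and> g \<midarrow>t\<rightarrow> g t \<and> \<not> is_pole g t" if "t \<in> U 1" for t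
  proof -
    have "g analytic_on {t}" using hg op that by (metis analytic_on_open analytic_on_subset empty_subsetI insert_subset)
    moreover have "isCont g t"
      using holomorphic_on_imp_continuous_on[OF hg] op that continuous_on_eq_continuous_at by blast
    then have "g \<midarrow>t\<rightarrow> g t" by (simp add: isCont_def)
    moreover have "\<not> is_pole g t"
      using \<open>g \<midarrow>t\<rightarrow> g t\<close> at_neq_bot is_pole_def not_tendsto_and_filterlim_at_infinity by blast
    ultimately show ?thesis by blast
  qed
  have off1: "g meromorphic_on {t} \<and> is_pole g t" if "t \<notin> U 1" for t
  proof -
    have t2: "t \<in> U 2" using that hcoord_nonzero[of "p t"] by (auto simp: U_def)
    have "x analytic_on {t}" using hx op t2 by (metis analytic_on_open analytic_on_subset empty_subsetI insert_subset)
    then have "g meromorphic_on {t}" unfolding gx by (intro meromorphic_intros analytic_on_imp_meromorphic_on)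
    moreover have "x \<midarrow>t\<rightarrow> 0"
    proof -
      have "isCont x t"
        using holomorphic_on_imp_continuous_on[OF hx] op t2 continuous_on_eq_continuous_at by blast
      moreover have "x t = 0" using that by (simp add: x_def U_def)
      ultimately show ?thesis by (simp add: isCont_def)
    qed
    moreover have "\<forall>\<^sub>F z in at t. x z \<noteq> 0"
      using p1_curve_isolated[OF p t0, of t] that by (simp add: x_def U_def eventually_conj_iff)
    ultimately have "filterlim x (at 0) (at t)" by (simp add: filterlim_at)
    then have "is_pole g t" unfolding is_pole_def gx
      by (rule filterlim_compose[OF filterlim_inverse_at_infinity])
    then show ?thesis using \<open>g meromorphic_on {t}\<close> by blast
  qed
  have "g meromorphic_on UNIV"
    unfolding meromorphic_on_meromorphic_at[of g UNIV]
    using on1 off1 analytic_on_imp_meromorphic_on by blast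
  \<comment> \<open>At the poles the denominator \<open>hcoord (p z) $ 1\<close> is 0, so division
    by zero gives \<open>g\<close> the value 0 that nice meromorphy prescribes there.\<close>
  moreover have "(is_pole g z \<and> g z = 0) \<or> g \<midarrow>z\<rightarrow> g z" for z
    using on1[of z] off1[of z] by (cases "z \<in> U 1") (auto simp: U_def g_def)
  ultimately have "g nicely_meromorphic_on UNIV" by (simp add: nicely_meromorphic_on_def)
  then obtain h f1 f2 where h: "h holomorphic_on UNIV" "f1 holomorphic_on UNIV" "f2 holomorphic_on UNIV"
    "\<forall>z. f1 z = 0 \<longleftrightarrow> \<not> is_pole g z \<and> g z = 0" "\<forall>z. f2 z = 0 \<longleftrightarrow> is_pole g z"
    "\<forall>z. \<not> is_pole g z \<longrightarrow> zorder f1 z = zorder g z" "\<forall>z. is_pole g z \<longrightarrow> zorder f2 z = - zorder g z"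
    "\<forall>z. h z \<noteq> 0" "\<forall>z. g z = h z * f1 z / f2 z"
    by (rule weierstrass_factorization_meromorphic_UNIV)
  have "vector [f2 t, h t * f1 t] \<in> reps (p t)" for t
  proof (cases "t \<in> U 1")
    case True
    then have "f2 t \<noteq> 0" using on1 h(5) by blast
    moreover have "hcoord (p t) $ 1 \<noteq> 0" using True by (simp add: U_def)
    moreover have "hcoord (p t) $ 2 / hcoord (p t) $ 1 = h t * f1 t / f2 t" using h(9) by (simp add: g_def)
    ultimately show ?thesis
      unfolding vector2_in_reps_iff by (intro exI[of _ "f2 t / hcoord (p t) $ 1"]) (auto simp: field_simps)
  next
    case False
    then have "f2 t = 0" "f1 t \<noteq> 0" using off1 h(4,5) by blast+
    moreover have "hcoord (p t) $ 1 = 0" "hcoord (p t) $ 2 \<noteq> 0" using False hcoord_nonzero[of "p t"] by (auto simp: U_def)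
    ultimately show ?thesis
      unfolding vector2_in_reps_iff using h(8) by (intro exI[of _ "h t * f1 t / hcoord (p t) $ 2"]) auto
  qed
  then show ?thesis using h by (intro exI[of _ f2] exI[of _ "\<lambda>t. h t * f1 t"]) (auto intro!: holomorphic_intros)
qed

text \<open>\<open>A\<close> is the form vanishing at the point \<open>p s\<close>, and
  \<open>B\<close> is its Hermitian complement, nonzero at \<open>s\<close>. The derivative of
  \<open>A / B\<close> is a multiple of the Wronskian, so \<open>A / B\<close> is constantly 0 near
  \<open>s\<close>, and \<open>A\<close> vanishes everywhere by analytic continuation.\<close>

lemma constant_of_vanishing_wronskian:
  assumes hol: "P1 holomorphic_on UNIV" "P2 holomorphic_on UNIV"
    and rep: "\<And>t. vector [P1 t, P2 t] \<in> reps (p t)" and W: "\<And>t. wronskian P1 P2 t = 0"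
  shows "p t = p s"
proof -
  define x where "x = P1 s"
  define y where "y = P2 s"
  have nz: "P1 t \<noteq> 0 \<or> P2 t \<noteq> 0" for t
    using reps_nonzero[OF rep[of t]] by (auto simp: vec2_eq_iff)
  define A where "A = (\<lambda>t. (- y) * P1 t + x * P2 t)"
  define B where "B = (\<lambda>t. cnj x * P1 t + cnj y * P2 t)"
  have holAB: "A holomorphic_on UNIV" "B holomorphic_on UNIV"
    unfolding A_def B_def by (intro holomorphic_intros hol)+
  have "B s \<noteq> 0"
  proof
    assume "B s = 0"
    have "of_real ((cmod x)^2 + (cmod y)^2) = B s"
      unfolding B_def x_def y_def of_real_add complex_norm_square by (simp add: mult.commute)
    with \<open>B s = 0\<close> have "(cmod x)^2 + (cmod y)^2 = 0" by (simp only: of_real_eq_0_iff)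
    then show False using nz[of s] by (simp add: x_def y_def add_nonneg_eq_0_iff)
  qed
  moreover have "continuous_on UNIV B" using holAB holomorphic_on_imp_continuous_on by blast
  ultimately obtain r where r: "r > 0" "\<And>z. z \<in> ball s r \<Longrightarrow> B z \<noteq> 0"
    using continuous_on_avoid[of UNIV B s 0] by (auto simp: dist_commute)
  have "A z / B z = A s / B s" if z: "z \<in> ball s r" for z
  proof (rule has_field_derivative_zero_constant[of "ball s r" "\<lambda>z. A z / B z", THEN exE])
    fix w assume w: "w \<in> ball s r"
    have "(A has_field_derivative deriv A w) (at w)" "(B has_field_derivative deriv B w) (at w)"
      using holAB by (auto intro: holomorphic_derivI[OF _ open_UNIV])
    then have "((\<lambda>z. A z / B z) has_field_derivative (deriv A w * B w - A w * deriv B w) / (B w * B w)) (at w)"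
      using r(2)[OF w] by (rule DERIV_divide)
    moreover have "deriv A w * B w - A w * deriv B w = 0"
    proof -
      have dA: "deriv A w = (- y) * deriv P1 w + x * deriv P2 w" and dB: "deriv B w = cnj x * deriv P1 w + cnj y * deriv P2 w"
        unfolding A_def B_def by (rule deriv_linear_combination[OF hol])+
      have "P1 w * deriv P2 w - P2 w * deriv P1 w = 0" using W[of w] by (simp add: wronskian_def)
      then show ?thesis unfolding dA dB unfolding A_def B_def by algebra
    qed
    ultimately show "((\<lambda>z. A z / B z) has_field_derivative 0) (at w within ball s r)"
      by (simp add: has_field_derivative_at_within)
  next
    fix c assume c: "\<forall>z\<in>ball s r. A z / B z = c"
    have "s \<in> ball s r" using r by simp
    then show ?thesis using c z by metis
  qed auto
  moreover have "A s = 0" by (simp add: A_def x_def y_def)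
  ultimately have "A z = 0" if "z \<in> ball s r" for z using that r(2) by force
  then have A0: "A t = 0"
    using analytic_continuation_open[of "ball s r" UNIV A "\<lambda>_. 0" t] r(1) holAB(1)
    by (simp add: connected_UNIV)
  have "vector [P1 s, P2 s] \<in> reps (p t)"
  proof -
    define c where "c = (if P1 t \<noteq> 0 then x / P1 t else y / P2 t)"
    have xy: "x * P2 t = y * P1 t" using A0 by (simp add: A_def)
    have "x = c * P1 t \<and> y = c * P2 t"
      using xy nz[of t] nz[of s] by (auto simp: c_def x_def y_def field_simps)
    moreover from this have "c \<noteq> 0" using nz[of s] by (auto simp: x_def y_def)
    ultimately show ?thesis
      unfolding reps_scale[OF rep[of t]] by (auto simp: vec2_eq_iff x_def y_def)
  qed
  then show ?thesis using rep[of s] p1_eqI by blast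
qed

section \<open>Curves in the tower\<close>

text \<open>Proportional forms share the zero \<open>[b i, - a i]\<close>, so their points would
  coincide. A zero form is excluded because the projective line has more than one point.\<close>

lemma forms_independent:
  fixes \<phi> :: "'i \<Rightarrow> p1"
  assumes inj: "inj_on \<phi> I"
    and l: "\<And>i p. i \<in> I \<Longrightarrow> (\<forall>v\<in>reps p. a i * v $ 1 + b i * v $ 2 = 0) \<longleftrightarrow> p = \<phi> i"
    and ij: "i \<in> I" "j \<in> I" "i \<noteq> j"
  shows "a i * b j \<noteq> a j * b i"
proof
  assume eq: "a i * b j = a j * b i"
  have nz: "a i \<noteq> 0 \<or> b i \<noteq> 0"
  proof (rule ccontr)
    assume "\<not> (a i \<noteq> 0 \<or> b i \<noteq> 0)"
    then have all: "p = \<phi> i" for p using l[OF ij(1), of p] by simp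
    obtain p where p: "vector [1, 0] \<in> reps p" using ex_reps[of "vector [1, 0]"] by (auto simp: vec2_eq_iff)
    obtain p' where p': "vector [0, 1] \<in> reps p'" using ex_reps[of "vector [0, 1]"] by (auto simp: vec2_eq_iff)
    have "vector [0, 1] \<in> reps p" using p' all by metis
    then show False unfolding reps_scale[OF p] by (auto simp: vec2_eq_iff)
  qed
  define v :: "complex ^ 2" where "v = vector [b i, - a i]"
  have "v \<noteq> 0" using nz by (auto simp: v_def vec2_eq_iff)
  then obtain p where p: "v \<in> reps p" using ex_reps by blast
  have "a i * w $ 1 + b i * w $ 2 = 0" "a j * w $ 1 + b j * w $ 2 = 0" if "w \<in> reps p" for w
    using that eq unfolding reps_scale[OF p] by (auto simp: v_def algebra_simps)
  then have "p = \<phi> i" "p = \<phi> j" using l ij by blast+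
  then show False using inj ij by (auto dest: inj_onD)
qed

lemma vertical_forms:
  assumes fin: "finite I" and F: "\<And>i. i \<in> I \<Longrightarrow> vertical_fibre (F i)" and inj: "inj_on F I"
    and l: "\<And>i. i \<in> I \<Longrightarrow> vertical_equation (F i) (l i)"
  shows "\<exists>a b. lines I a b \<and> (\<forall>i\<in>I. \<forall>v. l i v = a i * v $ 1 + b i * v $ 2)"
proof -
  have "\<forall>i\<in>I. \<exists>p. F i = {p} \<times> UNIV" using F by (simp add: vertical_fibre_def)
  from bchoice[OF this] obtain \<phi> where \<phi>: "\<And>i. i \<in> I \<Longrightarrow> F i = {\<phi> i} \<times> UNIV" by blast
  have "\<forall>i\<in>I. \<exists>c. \<forall>v. l i v = fst c * v $ 1 + snd c * v $ 2" using l by (force simp: vertical_equation_def)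
  from bchoice[OF this] obtain c where c: "\<And>i v. i \<in> I \<Longrightarrow> l i v = fst (c i) * v $ 1 + snd (c i) * v $ 2" by blast
  have "lines I (\<lambda>i. fst (c i)) (\<lambda>i. snd (c i))"
  proof
    show "fst (c i) * snd (c j) \<noteq> fst (c j) * snd (c i)" if ij: "i \<in> I" "j \<in> I" "i \<noteq> j" for i j
    proof (rule forms_independent[OF _ _ ij])
      show "inj_on \<phi> I" using inj \<phi> by (auto simp: inj_on_def)
      fix i p assume i: "i \<in> I"
      have "{\<phi> i} \<times> UNIV = {P :: p1 \<times> p1. \<forall>v\<in>reps (fst P). l i v = 0}"
        using l[OF i] \<phi>[OF i] by (simp add: vertical_equation_def)
      then have "(p, p) \<in> {\<phi> i} \<times> UNIV \<longleftrightarrow> (\<forall>v\<in>reps p. l i v = 0)" unfolding \<open>_ = Collect _\<close> by simp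
      then show "(\<forall>v\<in>reps p. fst (c i) * v $ 1 + snd (c i) * v $ 2 = 0) \<longleftrightarrow> p = \<phi> i" using c[OF i] by auto
    qed
  qed (rule fin)
  then show ?thesis using c by blast
qed

lemma horizontal_forms:
  assumes fin: "finite I" and G: "\<And>i. i \<in> I \<Longrightarrow> horizontal_fibre (G i)" and inj: "inj_on G I"
    and l: "\<And>i. i \<in> I \<Longrightarrow> horizontal_equation (G i) (l i)"
  shows "\<exists>a b. lines I a b \<and> (\<forall>i\<in>I. \<forall>v. l i v = a i * v $ 1 + b i * v $ 2)"
proof -
  have swap: "prod.swap ` ({p} \<times> UNIV) = UNIV \<times> {p}" "prod.swap ` (UNIV \<times> {p}) = {p} \<times> UNIV" for p :: p1
    by force+
  have "vertical_fibre (prod.swap ` G i)" if "i \<in> I" for i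
    using G[OF that] by (auto simp: horizontal_fibre_def vertical_fibre_def swap)
  moreover have "inj_on (\<lambda>i. prod.swap ` G i) I"
    using inj by (auto simp: inj_on_def inj_image_eq_iff)
  moreover have "vertical_equation (prod.swap ` G i) (l i)" if "i \<in> I" for i
    using l[OF that] by (force simp: horizontal_equation_def vertical_equation_def image_iff)
  ultimately show ?thesis using fin by (intro vertical_forms) auto
qed

section \<open>Truncations, charts and adjoined roots along a curve\<close>

lemma holomorphic_curve_regular:
  assumes g: "holomorphic_curve V g" and h: "regular_on_chart V i h"
  shows "(\<lambda>t. h (g t)) holomorphic_on (g -` chart V i)"
proof -
  obtain r where r: "r \<in> generated_algebra (coords V i)" "\<And>x. x \<in> chart V i \<Longrightarrow> h x = r x"
    using h by (auto simp: regular_on_chart_def)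
  from r(1) have "(\<lambda>t. r (g t)) holomorphic_on (g -` chart V i)"
  proof induction
    case (gen c)
    then show ?case using g by (auto simp: holomorphic_curve_def)
  qed (auto intro!: holomorphic_intros)
  then show ?thesis by (rule holomorphic_transform) (use r(2) in auto)
qed

lemma cyclic_cover_points:
  assumes "x \<in> points (cyclic_cover m \<sigma> V)"
  shows "cover_map x \<in> points V" "last (snd x) \<in> bundle_fibre 1 1 (fst x)"
    "\<And>v w. v \<in> reps (fst (fst x)) \<Longrightarrow> w \<in> reps (snd (fst x)) \<Longrightarrow> last (snd x) v w ^ m = \<sigma> (cover_map x) v w"
  using assms by (auto simp: cyclic_cover_def cover_map_def)

lemma cyclic_cover_curve:
  assumes g: "holomorphic_curve (cyclic_cover m \<sigma> V) g"
  shows "holomorphic_curve V (\<lambda>t. cover_map (g t))"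
    and "(\<lambda>t. frame_coord 1 1 i (fst (g t)) (last (snd (g t)))) holomorphic_on ((\<lambda>t. cover_map (g t)) -` chart V i)"
proof -
  have pts: "g t \<in> points (cyclic_cover m \<sigma> V)" for t using g by (auto simp: holomorphic_curve_def)
  then have pre: "g -` chart (cyclic_cover m \<sigma> V) i = (\<lambda>t. cover_map (g t)) -` chart V i" for i
    by (auto simp: cyclic_cover_def)
  have 1: "open (g -` chart (cyclic_cover m \<sigma> V) i)"
    and 2: "c \<in> coords (cyclic_cover m \<sigma> V) i \<Longrightarrow> (\<lambda>t. c (g t)) holomorphic_on (g -` chart (cyclic_cover m \<sigma> V) i)" for i c
    using g unfolding holomorphic_curve_def by blast+
  have "(\<lambda>t. c (cover_map (g t))) holomorphic_on ((\<lambda>t. cover_map (g t)) -` chart V i)" if "c \<in> coords V i" for c i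
    using 2[of "c \<circ> cover_map" i] that unfolding pre by (auto simp: cyclic_cover_def)
  then show "holomorphic_curve V (\<lambda>t. cover_map (g t))"
    using cyclic_cover_points(1)[OF pts] 1 unfolding pre by (auto simp: holomorphic_curve_def)
  show "(\<lambda>t. frame_coord 1 1 i (fst (g t)) (last (snd (g t)))) holomorphic_on ((\<lambda>t. cover_map (g t)) -` chart V i)"
    using 2[of "\<lambda>x. frame_coord 1 1 i (fst x) (last (snd x))" i] unfolding pre by (auto simp: cyclic_cover_def)
qed

lemma tower_points_length: "x \<in> points (tower m s k) \<Longrightarrow> length (snd x) = k"
  by (induction k arbitrary: x) (fastforce simp: P1xP1_def cyclic_cover_def)+

lemma tower_chart: "chart (tower m s k) i = {x \<in> points (tower m s k). fst x \<in> std_chart i}"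
proof (induction k)
  case (Suc k)
  have "fst (cover_map x) = fst x" for x by (simp add: cover_map_def)
  then show ?case using Suc cyclic_cover_points(1)[of _ m "s k" "tower m s k"] by (auto simp: cyclic_cover_def)
qed (auto simp: P1xP1_def)

text \<open>The composed covering map onto the \<open>k\<close>-th surface.\<close>

definition trunc_point :: "nat \<Rightarrow> tower_point \<Rightarrow> tower_point" where
  "trunc_point k x = (fst x, take k (snd x))"

lemma tower_curve_truncate:
  assumes f: "holomorphic_curve (tower m s n) f" and "k \<le> n"
  shows "holomorphic_curve (tower m s k) (\<lambda>t. trunc_point k (f t))"
  using \<open>k \<le> n\<close>
proof (induction k rule: inc_induct)
  have len: "length (snd (f t)) = n" for t
    using f tower_points_length[of "f t" m s n] by (auto simp: holomorphic_curve_def)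
  {
    case base
    have "trunc_point n (f t) = f t" for t using len[of t] by (simp add: trunc_point_def)
    then show ?case using f by simp
  next
    case (step k)
    have "cover_map (trunc_point (Suc k) (f t)) = trunc_point k (f t)" for t
      using len[of t] step(2) by (simp add: trunc_point_def cover_map_def butlast_take)
    then show ?case using cyclic_cover_curve(1)[OF step(3)[unfolded tower.simps]] by simp
  }
qed

lemma tower_curve_charts:
  assumes f: "holomorphic_curve (tower m s n) f"
  shows "open {t. fst (f t) \<in> std_chart i}"
    and "p1_curve (\<lambda>t. fst (fst (f t)))" and "p1_curve (\<lambda>t. snd (fst (f t)))"
proof -
  define T where "T = (\<lambda>i. {t. fst (f t) \<in> std_chart i})"
  have f0: "holomorphic_curve P1xP1 (\<lambda>t. trunc_point 0 (f t))"
    using tower_curve_truncate[OF f, of 0] by simp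
  have pre: "(\<lambda>t. trunc_point 0 (f t)) -` chart P1xP1 i = T i" for i
    by (auto simp: P1xP1_def trunc_point_def T_def)
  have op: "open (T i)" for i using f0 unfolding holomorphic_curve_def pre by blast
  then show "open {t. fst (f t) \<in> std_chart i}" by (simp add: T_def)
  have hol: "(\<lambda>t. c (trunc_point 0 (f t))) holomorphic_on T i" if "c \<in> coords P1xP1 i" for c i
    using f0 that unfolding holomorphic_curve_def pre by blast
  have h1: "(\<lambda>t. hcoord (fst (fst (f t))) $ a / hcoord (fst (fst (f t))) $ fst i) holomorphic_on T i" for a i
    using hol[of "\<lambda>x. hcoord (fst (fst x)) $ a / hcoord (fst (fst x)) $ fst i" i] by (auto simp: P1xP1_def trunc_point_def)
  have h2: "(\<lambda>t. hcoord (snd (fst (f t))) $ a / hcoord (snd (fst (f t))) $ snd i) holomorphic_on T i" for a i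
    using hol[of "\<lambda>x. hcoord (snd (fst x)) $ a / hcoord (snd (fst x)) $ snd i" i] by (auto simp: P1xP1_def trunc_point_def)
  have U1: "{t. hcoord (fst (fst (f t))) $ i \<noteq> 0} = T (i, 1) \<union> T (i, 2)" for i
    using hcoord_nonzero by (auto simp: T_def std_chart_def)
  have U2: "{t. hcoord (snd (fst (f t))) $ i \<noteq> 0} = T (1, i) \<union> T (2, i)" for i
    using hcoord_nonzero by (auto simp: T_def std_chart_def)
  show "p1_curve (\<lambda>t. fst (fst (f t)))"
    unfolding p1_curve_def U1
  proof (intro allI conjI)
    fix i a
    show "open (T (i, 1) \<union> T (i, 2))" using op by blast
    show "(\<lambda>t. hcoord (fst (fst (f t))) $ a / hcoord (fst (fst (f t))) $ i) holomorphic_on T (i, 1) \<union> T (i, 2)"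
      using h1[of a "(i, 1)"] h1[of a "(i, 2)"] op by (intro holomorphic_on_Un) auto
  qed
  show "p1_curve (\<lambda>t. snd (fst (f t)))"
    unfolding p1_curve_def U2
  proof (intro allI conjI)
    fix i a
    show "open (T (1, i) \<union> T (2, i))" using op by blast
    show "(\<lambda>t. hcoord (snd (fst (f t))) $ a / hcoord (snd (fst (f t))) $ i) holomorphic_on T (1, i) \<union> T (2, i)"
      using h2[of a "(1, i)"] h2[of a "(2, i)"] op by (intro holomorphic_on_Un) auto
  qed
qed

lemma ex_std_chart: "\<exists>i. P \<in> std_chart i"
proof -
  obtain a b where "hcoord (fst P) $ a \<noteq> 0" "hcoord (snd P) $ b \<noteq> 0" using hcoord_nonzero by metis
  then show ?thesis by (intro exI[of _ "(a, b)"]) (simp add: std_chart_def)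
qed

lemma entire_from_charts:
  assumes f: "holomorphic_curve (tower m s n) f"
    and \<phi>: "\<And>i. \<phi> holomorphic_on {t. fst (f t) \<in> std_chart i}"
  shows "\<phi> holomorphic_on UNIV"
proof -
  have "\<phi> holomorphic_on (\<Union>i. {t. fst (f t) \<in> std_chart i})"
    using \<phi> tower_curve_charts(1)[OF f] by (intro holomorphic_on_UN_open) auto
  moreover have "t \<in> (\<Union>i. {t. fst (f t) \<in> std_chart i})" for t
    using ex_std_chart[of "fst (f t)"] by blast
  then have "(\<Union>i. {t. fst (f t) \<in> std_chart i}) = UNIV" by blast
  ultimately show ?thesis by simp
qed

lemma tower_curve_truncate_vimage:
  assumes f: "holomorphic_curve (tower m s n) f" and "k \<le> n"
  shows "(\<lambda>t. trunc_point k (f t)) -` chart (tower m s k) i = {t. fst (f t) \<in> std_chart i}"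
  using tower_curve_truncate[OF assms]
  unfolding tower_chart holomorphic_curve_def by (auto simp: trunc_point_def)

text \<open>The entry with index \<open>k\<close> is adjoined in passing from level \<open>k\<close>
  to level \<open>Suc k\<close>, so truncation to length \<open>Suc k\<close> makes it the last
  one.\<close>

lemma tower_curve_root:
  assumes f: "holomorphic_curve (tower m s n) f" and k: "k < n"
  shows "snd (f t) ! k \<in> bundle_fibre 1 1 (fst (f t))"
    and "\<And>v w. v \<in> reps (fst (fst (f t))) \<Longrightarrow> w \<in> reps (snd (fst (f t))) \<Longrightarrow>
           (snd (f t) ! k) v w ^ m = s k (trunc_point k (f t)) v w"
    and "(\<lambda>t. frame_coord 1 1 i (fst (f t)) (snd (f t) ! k)) holomorphic_on {t. fst (f t) \<in> std_chart i}"
proof -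
  have f': "holomorphic_curve (cyclic_cover m (s k) (tower m s k)) (\<lambda>t. trunc_point (Suc k) (f t))"
    using tower_curve_truncate[OF f, of "Suc k"] k by simp
  have pts: "trunc_point (Suc k) (f t) \<in> points (cyclic_cover m (s k) (tower m s k))" for t
    using f' by (auto simp: holomorphic_curve_def)
  have len: "length (snd (f t)) = n" for t
    using f tower_points_length[of "f t" m s n] by (auto simp: holomorphic_curve_def)
  have cov: "cover_map (trunc_point (Suc k) (f t)) = trunc_point k (f t)" for t
    using len[of t] k by (simp add: trunc_point_def cover_map_def butlast_take)
  have last: "last (snd (trunc_point (Suc k) (f t))) = snd (f t) ! k" for t
    using len[of t] k by (simp add: trunc_point_def take_Suc_conv_app_nth)
  have fst: "fst (trunc_point j (f t)) = fst (f t)" for j t by (simp add: trunc_point_def)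
  show "snd (f t) ! k \<in> bundle_fibre 1 1 (fst (f t))"
    using cyclic_cover_points(2)[OF pts[of t]] unfolding last fst .
  show "(snd (f t) ! k) v w ^ m = s k (trunc_point k (f t)) v w"
    if "v \<in> reps (fst (fst (f t)))" "w \<in> reps (snd (fst (f t)))" for v w
    using cyclic_cover_points(3)[OF pts[of t], unfolded last fst cov] that by blast
  show "(\<lambda>t. frame_coord 1 1 i (fst (f t)) (snd (f t) ! k)) holomorphic_on {t. fst (f t) \<in> std_chart i}"
    using cyclic_cover_curve(2)[OF f', of i] tower_curve_truncate_vimage[OF f, of k i] k
    unfolding last fst cov by simp
qed

lemma bundle_fibre_frame:
  assumes \<phi>: "\<phi> \<in> bundle_fibre 1 1 P" and i: "P \<in> std_chart i" and v: "v \<in> reps (fst P)" and w: "w \<in> reps (snd P)"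
  shows "\<phi> v w = frame_coord 1 1 i P \<phi> * (v $ fst i) * (w $ snd i)"
proof -
  obtain c where c: "c \<noteq> 0" "v = c *s hcoord (fst P)" using v reps_scale[OF hcoord_in_reps] by blast
  obtain d where d: "d \<noteq> 0" "w = d *s hcoord (snd P)" using w reps_scale[OF hcoord_in_reps] by blast
  have "\<phi> v w = c * d * \<phi> (hcoord (fst P)) (hcoord (snd P))"
    using \<phi> c d hcoord_in_reps unfolding bundle_fibre_def by auto
  then show ?thesis using i unfolding c d std_chart_def frame_coord_def by (simp add: field_simps)
qed

text \<open>The homogeneous lifts trivialize the pull-back of the bundle \<open>(1,1)\<close> to the
  plane. Evaluating the adjoined root on them therefore gives one entire function \<open>Z\<close>,
  not just a function on each chart; \<open>u\<close> is the unit comparing the section with the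
  product of the equations.\<close>

lemma tower_curve_equation:
  assumes f: "holomorphic_curve (tower m s n) f" and k: "k < n"
    and div: "zero_divisor_is_pullback (tower m s k) (s k) F G B"
    and P: "P1 holomorphic_on UNIV" "P2 holomorphic_on UNIV" "\<And>t. vector [P1 t, P2 t] \<in> reps (fst (fst (f t)))"
    and Q: "Q1 holomorphic_on UNIV" "Q2 holomorphic_on UNIV" "\<And>t. vector [Q1 t, Q2 t] \<in> reps (snd (fst (f t)))"
  shows "\<exists>l l' u Z. (\<forall>i\<in>B. vertical_equation (F i) (l i) \<and> horizontal_equation (G i) (l' i)) \<and>
    u holomorphic_on UNIV \<and> (\<forall>t. u t \<noteq> 0) \<and> Z holomorphic_on UNIV \<and>
    (\<forall>t. Z t ^ m = u t * ((\<Prod>i\<in>B. l i (vector [P1 t, P2 t])) * (\<Prod>i\<in>B. l' i (vector [Q1 t, Q2 t]))))"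
proof -
  define X where "X = (\<lambda>t. trunc_point k (f t))"
  have X: "holomorphic_curve (tower m s k) X" unfolding X_def using tower_curve_truncate[OF f] k by simp
  have Xpts: "X t \<in> points (tower m s k)" for t using X by (auto simp: holomorphic_curve_def)
  have fstX: "fst (X t) = fst (f t)" for t by (simp add: X_def trunc_point_def)
  obtain l l' h where l: "\<forall>i\<in>B. vertical_equation (F i) (l i) \<and> horizontal_equation (G i) (l' i)"
    and h: "regular_unit (tower m s k) h"
    and eq: "\<And>x v w. x \<in> points (tower m s k) \<Longrightarrow> v \<in> reps (fst (fst x)) \<Longrightarrow> w \<in> reps (snd (fst x)) \<Longrightarrow>
           s k x v w = h x * ((\<Prod>i\<in>B. l i v) * (\<Prod>i\<in>B. l' i w))"
    using div unfolding zero_divisor_is_pullback_def by blast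
  define u where "u = (\<lambda>t. h (X t))"
  have "u holomorphic_on UNIV"
  proof (rule entire_from_charts[OF f])
    fix i
    have "regular_on_chart (tower m s k) i h" using h unfolding regular_unit_def by blast
    from holomorphic_curve_regular[OF X this]
    show "u holomorphic_on {t. fst (f t) \<in> std_chart i}"
      using tower_curve_truncate_vimage[OF f, of k i] k by (simp add: u_def X_def)
  qed
  moreover have "u t \<noteq> 0" for t using h Xpts by (simp add: regular_unit_def u_def)
  moreover define Z where "Z = (\<lambda>t. (snd (f t) ! k) (vector [P1 t, P2 t]) (vector [Q1 t, Q2 t]))"
  have comp: "(\<lambda>t. (vector [g t, g' t] :: complex ^ 2) $ a) holomorphic_on UNIV"
    if "g holomorphic_on UNIV" "g' holomorphic_on UNIV" for g g' and a :: 2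
    using that exhaust_2[of a] by auto
  have "Z holomorphic_on UNIV"
  proof (rule entire_from_charts[OF f])
    fix i
    have "(\<lambda>t. frame_coord 1 1 i (fst (f t)) (snd (f t) ! k) * (vector [P1 t, P2 t] :: complex ^ 2) $ fst i * (vector [Q1 t, Q2 t] :: complex ^ 2) $ snd i)
        holomorphic_on {t. fst (f t) \<in> std_chart i}"
      by (intro holomorphic_intros tower_curve_root(3)[OF f k] holomorphic_on_subset[OF comp] P Q) auto
    then show "Z holomorphic_on {t. fst (f t) \<in> std_chart i}"
      by (rule holomorphic_transform)
         (use bundle_fibre_frame[OF tower_curve_root(1)[OF f k] _ P(3) Q(3)] in \<open>auto simp: Z_def\<close>)
  qed
  moreover have "Z t ^ m = u t * ((\<Prod>i\<in>B. l i (vector [P1 t, P2 t])) * (\<Prod>i\<in>B. l' i (vector [Q1 t, Q2 t])))" for t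
    unfolding Z_def u_def tower_curve_root(2)[OF f k P(3) Q(3)] X_def[symmetric]
    using eq[OF Xpts[of t]] P(3) Q(3) fstX X_def by auto
  ultimately show ?thesis using l by blast
qed

text \<open>Over a fixed base point the root has a constant \<open>m\<close>-th power, hence is
  bounded, hence constant by Liouville. The induction on the level is needed because the section at
  level \<open>k\<close> depends on the earlier roots.\<close>

lemma tower_curve_constant:
  assumes f: "holomorphic_curve (tower m s n) f" and m: "m > 0" and base: "\<And>t. fst (f t) = b"
  shows "f t = f 0"
proof -
  have len: "length (snd (f t)) = n" for t
    using f tower_points_length[of "f t" m s n] by (auto simp: holomorphic_curve_def)
  have "take k (snd (f t)) = take k (snd (f 0))" if "k \<le> n" for k t
    using that
  proof (induction k arbitrary: t)
    case (Suc k)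
    then have k: "k < n" and IH: "take k (snd (f t)) = take k (snd (f 0))" for t by auto
    obtain i where i: "b \<in> std_chart i" using ex_std_chart by blast
    define \<phi> where "\<phi> = (\<lambda>t. frame_coord 1 1 i b (snd (f t) ! k))"
    have "\<phi> holomorphic_on UNIV"
      using tower_curve_root(3)[OF f k, of i] i by (simp add: base \<phi>_def)
    define v where "v = hcoord (fst b)"
    define w where "w = hcoord (snd b)"
    have vw: "v \<in> reps (fst b)" "w \<in> reps (snd b)" by (auto simp: v_def w_def hcoord_in_reps)
    define c where "c = v $ fst i * w $ snd i"
    have "c \<noteq> 0" using i by (simp add: c_def v_def w_def std_chart_def)
    have \<phi>c: "(snd (f t) ! k) v w = \<phi> t * c" for t
      using bundle_fibre_frame[OF tower_curve_root(1)[OF f k, of t, unfolded base] i vw] by (simp add: \<phi>_def c_def)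
    have root: "(\<phi> t * c) ^ m = s k (trunc_point k (f 0)) v w" for t
      using tower_curve_root(2)[OF f k, of v t w] vw IH[of t] unfolding base \<phi>c trunc_point_def by simp
    define C where "C = cmod (s k (trunc_point k (f 0)) v w)"
    have "cmod (\<phi> t * c) \<le> max 1 C" for t
    proof (cases "cmod (\<phi> t * c) \<le> 1")
      case False
      then have "cmod (\<phi> t * c) ^ 1 \<le> cmod (\<phi> t * c) ^ m" using m by (intro power_increasing) auto
      then show ?thesis using root[of t] by (simp add: C_def norm_power[symmetric])
    qed simp
    then have "bounded (range (\<lambda>t. \<phi> t * c))" by (auto simp: bounded_iff)
    moreover have "(\<lambda>t. \<phi> t * c) holomorphic_on UNIV" by (intro holomorphic_intros \<open>\<phi> holomorphic_on UNIV\<close>)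
    ultimately obtain e where "\<And>t. \<phi> t * c = e" using Liouville_theorem unfolding constant_on_def by blast
    then have const: "\<phi> t = \<phi> 0" for t using \<open>c \<noteq> 0\<close> by (metis mult_cancel_right)
    have "(snd (f t) ! k) v' w' = (snd (f 0) ! k) v' w'" for t v' w'
    proof (cases "v' \<in> reps (fst b) \<and> w' \<in> reps (snd b)")
      case True
      then show ?thesis
        using bundle_fibre_frame[OF tower_curve_root(1)[OF f k, of t, unfolded base] i, of v' w']
          bundle_fibre_frame[OF tower_curve_root(1)[OF f k, of 0, unfolded base] i, of v' w'] const[of t]
        by (simp add: \<phi>_def)
    next
      case False
      then show ?thesis
        using tower_curve_root(1)[OF f k, of t, unfolded base] tower_curve_root(1)[OF f k, of 0, unfolded base]
        by (auto simp: bundle_fibre_def)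
    qed
    then have "snd (f t) ! k = snd (f 0) ! k" for t by blast
    then show ?case using IH[of t] len k by (simp add: take_Suc_conv_app_nth)
  qed simp
  from this[of n t] show ?thesis using len base by (simp add: prod_eq_iff)
qed

section \<open>One constant factor\<close>

lemma lines_subset: "lines I a b \<Longrightarrow> J \<subseteq> I \<Longrightarrow> lines J a b"
  unfolding lines_def by (meson finite_subset subset_eq)

text \<open>Squaring the equation doubles the exponent to \<open>2 * m\<close>; with
  \<open>\<theta> = 1/2\<close> the two numerical conditions become \<open>card I > 4\<close> and
  \<open>m > 2\<close>.\<close>

lemma vanishing_wronskian_single:
  assumes P: "projective_curve P1 P2" and L: "lines I a b" and card: "card I > 4" and m: "m > 2"
    and Z: "Z holomorphic_on UNIV" and u: "u holomorphic_on UNIV" "\<And>t. u t \<noteq> 0"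
    and eq: "\<And>t. (\<Prod>i\<in>I. a i * P1 t + b i * P2 t) = u t * Z t ^ m"
  shows "wronskian P1 P2 t = 0"
proof -
  have c: "curve_and_lines P1 P2 I a b" using P L by (simp add: curve_and_lines_def)
  have "(\<forall>z. wronskian P1 P2 z = 0) \<or> (\<forall>z. wronskian P1 P2 z = 0)"
  proof (rule vanishing_wronskian[OF c c, of "1/2" "2 * m" Z "\<lambda>t. u t ^ 2"])
    show "(\<lambda>t. u t ^ 2) holomorphic_on UNIV" using u by (intro holomorphic_intros)
    show "(\<Prod>i\<in>I. a i * P1 t + b i * P2 t) * (\<Prod>i\<in>I. a i * P1 t + b i * P2 t) = u t ^ 2 * Z t ^ (2 * m)" for t
      unfolding eq by (simp add: power2_eq_square mult_2 power_add)
  qed (use card m Z u in auto)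
  then show ?thesis by blast
qed

text \<open>Independent forms have no common zero on the curve, and the blocks are disjoint, so the
  constant image point annihilates forms of at most one block. In all other blocks the forms of the
  first curve are nowhere zero and pass into the unit \<open>U\<close>.\<close>

lemma vanishing_wronskian_second_factor:
  fixes B :: "nat \<Rightarrow> nat set"
  assumes nm: "n \<ge> 3" "m > 2"
    and P: "projective_curve P1 P2" and Q: "projective_curve Q1 Q2"
    and proportional: "\<And>t s. \<exists>c. c \<noteq> 0 \<and> P1 t = c * P1 s \<and> P2 t = c * P2 s"
    and B: "\<And>k. k < n \<Longrightarrow> finite (B k) \<and> card (B k) = m \<and> B k \<subseteq> I"
      "\<And>k k'. k < n \<Longrightarrow> k' < n \<Longrightarrow> k \<noteq> k' \<Longrightarrow> B k \<inter> B k' = {}"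
    and L: "lines I a b" and L': "lines I c d"
    and u: "\<And>k. k < n \<Longrightarrow> u k holomorphic_on UNIV" "\<And>k t. k < n \<Longrightarrow> u k t \<noteq> 0"
    and Z: "\<And>k. k < n \<Longrightarrow> Z k holomorphic_on UNIV"
    and eq: "\<And>k t. k < n \<Longrightarrow> Z k t ^ m = u k t * ((\<Prod>i\<in>B k. a i * P1 t + b i * P2 t) * (\<Prod>i\<in>B k. c i * Q1 t + d i * Q2 t))"
  shows "wronskian Q1 Q2 t = 0"
proof -
  interpret P: projective_curve P1 P2 by (rule P)
  interpret L: lines I a b by (rule L)
  define x where "x = (\<lambda>i t. a i * P1 t + b i * P2 t)"
  \<comment> \<open>If no form \<open>x i\<close> vanishes, any \<open>k0\<close> will do, possibly
    one with \<open>k0 \<ge> n\<close>; then no block is dropped.\<close>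
  have "\<exists>k0. \<forall>k<n. k \<noteq> k0 \<longrightarrow> (\<forall>i\<in>B k. \<forall>t. x i t \<noteq> 0)"
  proof (cases "\<exists>k0<n. \<exists>i0\<in>B k0. \<exists>t0. x i0 t0 = 0")
    case True
    then obtain k0 i0 t0 where 0: "k0 < n" "i0 \<in> B k0" "x i0 t0 = 0" by blast
    have "x i t \<noteq> 0" if k: "k < n" "k \<noteq> k0" "i \<in> B k" for k i t
    proof
      assume "x i t = 0"
      obtain e where e: "e \<noteq> 0" "P1 t = e * P1 t0" "P2 t = e * P2 t0" using proportional by blast
      have "e * x i t0 = 0" using \<open>x i t = 0\<close> by (simp add: x_def e algebra_simps)
      then have xi: "x i t0 = 0" using e by simp
      have "(a i0 * b i - a i * b i0) * P1 t0 = 0" "(a i0 * b i - a i * b i0) * P2 t0 = 0"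
        using xi 0(3) unfolding x_def by algebra+
      then have "a i0 * b i = a i * b i0" using P.no_common_zero[of t0] by auto
      moreover have "i0 \<noteq> i" using B(2)[OF k(1) 0(1) k(2)] k(3) 0(2) by blast
      moreover have "i0 \<in> I" "i \<in> I" using B(1)[OF 0(1)] B(1)[OF k(1)] k(3) 0(2) by auto
      ultimately show False using L.indep by blast
    qed
    then show ?thesis by blast
  qed blast
  then obtain k0 where k0: "\<And>k i t. k < n \<Longrightarrow> k \<noteq> k0 \<Longrightarrow> i \<in> B k \<Longrightarrow> x i t \<noteq> 0" by blast
  define K where "K = {..<n} - {k0}"
  define J where "J = (\<Union>k\<in>K. B k)"
  have K: "k < n" "k \<noteq> k0" if "k \<in> K" for k using that by (auto simp: K_def)
  have disj: "\<forall>k\<in>K. \<forall>k'\<in>K. k \<noteq> k' \<longrightarrow> B k \<inter> B k' = {}" using B(2) K by blast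
  have finK: "finite K" by (simp add: K_def)
  have finB: "\<forall>k\<in>K. finite (B k)" using B(1) K by blast
  have "card K \<ge> 2"
    using nm by (cases "k0 < n") (auto simp: K_def)
  moreover have "card J = (\<Sum>k\<in>K. card (B k))"
    unfolding J_def by (rule card_UN_disjoint[OF finK finB disj])
  then have "card J = card K * m" using B(1) K by simp
  \<comment> \<open>At least two blocks of at least three forms each: this is where
    \<open>n \<ge> 3\<close> enters.\<close>
  ultimately have "card J > 4" using nm mult_le_mono[of 2 "card K" 3 m] by simp
  have prodJ: "(\<Prod>i\<in>J. g i) = (\<Prod>k\<in>K. \<Prod>i\<in>B k. g i)" for g :: "nat \<Rightarrow> complex"
    unfolding J_def by (rule prod.UNION_disjoint[OF finK finB disj])
  define U where "U = (\<lambda>t. inverse ((\<Prod>k\<in>K. u k t) * (\<Prod>i\<in>J. x i t)))"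
  have finJ: "finite J" unfolding J_def using finK finB by simp
  have xJ: "x i t \<noteq> 0" if "i \<in> J" for i t using that k0 K unfolding J_def by blast
  have nz: "(\<Prod>k\<in>K. u k t) * (\<Prod>i\<in>J. x i t) \<noteq> 0" for t
  proof -
    have "\<forall>k\<in>K. u k t \<noteq> 0" "\<forall>i\<in>J. x i t \<noteq> 0" using u(2) K(1) xJ by blast+
    then show ?thesis using finK finJ by simp
  qed
  show ?thesis
  proof (rule vanishing_wronskian_single[OF Q lines_subset[OF L'] \<open>card J > 4\<close> nm(2), of "\<lambda>t. \<Prod>k\<in>K. Z k t" U])
    show "J \<subseteq> I" using B(1) K by (auto simp: J_def)
    show "(\<lambda>t. \<Prod>k\<in>K. Z k t) holomorphic_on UNIV" using Z K by (intro holomorphic_intros) auto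
    show "U holomorphic_on UNIV"
      unfolding U_def x_def using nz u(1) K unfolding x_def by (intro holomorphic_intros P.hol) auto
    show "U t \<noteq> 0" for t using nz[of t] unfolding U_def by (rule nonzero_imp_inverse_nonzero)
    show "(\<Prod>i\<in>J. c i * Q1 t + d i * Q2 t) = U t * (\<Prod>k\<in>K. Z k t) ^ m" for t
    proof -
      have "(\<Prod>k\<in>K. Z k t) ^ m = (\<Prod>k\<in>K. u k t * ((\<Prod>i\<in>B k. x i t) * (\<Prod>i\<in>B k. c i * Q1 t + d i * Q2 t)))"
        unfolding prod_power_distrib using eq K by (intro prod.cong refl) (auto simp: x_def)
      also have "\<dots> = (\<Prod>k\<in>K. u k t) * (\<Prod>i\<in>J. x i t) * (\<Prod>i\<in>J. c i * Q1 t + d i * Q2 t)"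
        unfolding prodJ prod.distrib by (simp add: mult.assoc)
      finally have "U t * (\<Prod>k\<in>K. Z k t) ^ m = U t * ((\<Prod>k\<in>K. u k t) * (\<Prod>i\<in>J. x i t)) * (\<Prod>i\<in>J. c i * Q1 t + d i * Q2 t)"
        by (simp only: mult.assoc)
      also have "U t * ((\<Prod>k\<in>K. u k t) * (\<Prod>i\<in>J. x i t)) = 1"
        unfolding U_def by (rule left_inverse[OF nz])
      finally show ?thesis by simp
    qed
  qed
qed

section \<open>Hyperbolicity of the tower\<close>

theorem theorem1p1:
  fixes n m :: nat
    and F G :: "nat \<Rightarrow> (p1 \<times> p1) set"
    and s :: "nat \<Rightarrow> tower_point \<Rightarrow> bundle_elt"
  assumes "n \<ge> 3" and "m > 2"
    and "\<And>i. i \<in> {1..n*m} \<Longrightarrow> vertical_fibre (F i)" and "inj_on F {1..n*m}"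
    and "\<And>i. i \<in> {1..n*m} \<Longrightarrow> horizontal_fibre (G i)" and "inj_on G {1..n*m}"
    and "\<And>k. k < n \<Longrightarrow> pullback_section (tower m s k) m m (s k)"
    and "\<And>k. k < n \<Longrightarrow>
           zero_divisor_is_pullback (tower m s k) (s k) F G {k*m+1..(k+1)*m}"
  shows "hyperbolic (tower m s n)"
  unfolding hyperbolic_def
proof (intro allI impI)
  fix f assume f: "holomorphic_curve (tower m s n) f"
  define p where "p = (\<lambda>t. fst (fst (f t)))"
  define q where "q = (\<lambda>t. snd (fst (f t)))"
  obtain P1 P2 where P: "P1 holomorphic_on UNIV" "P2 holomorphic_on UNIV" "\<And>t. vector [P1 t, P2 t] \<in> reps (p t)"
    using p1_curve_lift[OF tower_curve_charts(2)[OF f]] unfolding p_def by blast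
  obtain Q1 Q2 where Q: "Q1 holomorphic_on UNIV" "Q2 holomorphic_on UNIV" "\<And>t. vector [Q1 t, Q2 t] \<in> reps (q t)"
    using p1_curve_lift[OF tower_curve_charts(3)[OF f]] unfolding q_def by blast
  have PC: "projective_curve P1 P2"
    using P reps_nonzero[OF P(3)] by unfold_locales (auto simp: vec2_eq_iff)
  have QC: "projective_curve Q1 Q2"
    using Q reps_nonzero[OF Q(3)] by unfold_locales (auto simp: vec2_eq_iff)
  define I where "I = {1..n*m}"
  define B where "B = (\<lambda>k. {k*m+1..(k+1)*m})"
  \<comment> \<open>The blocks start at \<open>k * m + 1\<close>, so the block number of
    \<open>i\<close> is recovered from \<open>i - 1\<close>.\<close>
  have idx: "(i - 1) div m = k" if "i \<in> B k" for i k
  proof -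
    have "k * m \<le> i - 1" "i - 1 < (k + 1) * m" using that by (auto simp: B_def)
    then show ?thesis by (intro div_nat_eqI) (auto simp: mult.commute)
  qed
  have B: "finite (B k) \<and> card (B k) = m \<and> B k \<subseteq> I" if "k < n" for k
  proof -
    have "(k + 1) * m \<le> n * m" using that by (intro mult_right_mono) auto
    then show ?thesis by (auto simp: B_def I_def)
  qed
  have Bdisj: "B k \<inter> B k' = {}" if "k \<noteq> k'" for k k' using idx that by blast
  have IB: "I = (\<Union>k<n. B k)"
  proof
    show "I \<subseteq> (\<Union>k<n. B k)"
    proof
      fix i assume i: "i \<in> I"
      define k where "k = (i - 1) div m"
      have "i - 1 < n * m" using i by (auto simp: I_def)
      then have "k < n" unfolding k_def by (simp add: less_mult_imp_div_less)
      moreover have "k * m \<le> i - 1" "i - 1 < (k + 1) * m"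
        using assms(2) dividend_less_div_times[of m "i - 1"] by (auto simp: k_def)
      then have "i \<in> B k" using i by (auto simp: B_def I_def)
      ultimately show "i \<in> (\<Union>k<n. B k)" by blast
    qed
  qed (use B in auto)
  define R where "R = (\<lambda>k (l :: nat \<Rightarrow> complex ^ 2 \<Rightarrow> complex) l' (u :: complex \<Rightarrow> complex) Z.
    (\<forall>i\<in>B k. vertical_equation (F i) (l i) \<and> horizontal_equation (G i) (l' i)) \<and>
    u holomorphic_on UNIV \<and> (\<forall>t. u t \<noteq> 0) \<and> Z holomorphic_on UNIV \<and>
    (\<forall>t. Z t ^ m = u t * ((\<Prod>i\<in>B k. l i (vector [P1 t, P2 t])) * (\<Prod>i\<in>B k. l' i (vector [Q1 t, Q2 t])))))"
  have "\<forall>k. \<exists>l l' u Z. k < n \<longrightarrow> R k l l' u Z"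
    using tower_curve_equation[OF f _ assms(8) P[unfolded p_def] Q[unfolded q_def]]
    unfolding R_def B_def by blast
  then obtain l l' u Z where R: "\<And>k. k < n \<Longrightarrow> R k (l k) (l' k) (u k) (Z k)" by metis
  \<comment> \<open>Each level comes with its own choice of equations. Taking for \<open>i\<close>
    those of its own block merges them into one family on \<open>I\<close>, to which independence
    can be applied.\<close>
  have ve: "vertical_equation (F i) (l ((i - 1) div m) i)" and he: "horizontal_equation (G i) (l' ((i - 1) div m) i)" if i: "i \<in> I" for i
  proof -
    obtain k where k: "k < n" "i \<in> B k" using i IB by auto
    show "vertical_equation (F i) (l ((i - 1) div m) i)" "horizontal_equation (G i) (l' ((i - 1) div m) i)"
      using R[OF k(1)] k(2) unfolding idx[OF k(2)] R_def by auto
  qed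
  obtain a b where L: "lines I a b" and lab: "\<And>i v. i \<in> I \<Longrightarrow> l ((i - 1) div m) i v = a i * v $ 1 + b i * v $ 2"
    using vertical_forms[of I F "\<lambda>i. l ((i - 1) div m) i"] assms(3,4) ve unfolding I_def by blast
  obtain c d where L': "lines I c d" and lcd: "\<And>i v. i \<in> I \<Longrightarrow> l' ((i - 1) div m) i v = c i * v $ 1 + d i * v $ 2"
    using horizontal_forms[of I G "\<lambda>i. l' ((i - 1) div m) i"] assms(5,6) he unfolding I_def by blast
  have u: "u k holomorphic_on UNIV" "u k t \<noteq> 0" and Z: "Z k holomorphic_on UNIV" if "k < n" for k t
    using R[OF that] by (auto simp: R_def)
  have eq: "Z k t ^ m = u k t * ((\<Prod>i\<in>B k. a i * P1 t + b i * P2 t) * (\<Prod>i\<in>B k. c i * Q1 t + d i * Q2 t))" if k: "k < n" for k t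
  proof -
    have "l k i (vector [P1 t, P2 t]) = a i * P1 t + b i * P2 t" "l' k i (vector [Q1 t, Q2 t]) = c i * Q1 t + d i * Q2 t"
      if i: "i \<in> B k" for i
    proof -
      have "i \<in> I" using i B[OF k] by blast
      from lab[OF this] lcd[OF this] show "l k i (vector [P1 t, P2 t]) = a i * P1 t + b i * P2 t"
        "l' k i (vector [Q1 t, Q2 t]) = c i * Q1 t + d i * Q2 t" unfolding idx[OF i] by simp_all
    qed
    then show ?thesis using R[OF k] by (simp add: R_def)
  qed
  have card_I: "card I = n * m" by (simp add: I_def)
  have "n * m \<ge> 3 * 3" using assms(1,2) by (intro mult_mono) auto
  \<comment> \<open>\<open>n * m \<ge> 9\<close> gives 9/4 > 2; likewise
    \<open>m * (1 - 1/4) \<ge> 9/4\<close>, so \<open>1/4\<close> meets both conditions.\<close>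
  then have cI: "real (card I) * (1/4) > 2" unfolding card_I by linarith
  have "(\<forall>z. wronskian P1 P2 z = 0) \<or> (\<forall>z. wronskian Q1 Q2 z = 0)"
  \<comment> \<open>Multiplying the equations of all levels gives a single \<open>m\<close>-th power
    up to a unit.\<close>
  proof (rule vanishing_wronskian[of P1 P2 I a b Q1 Q2 I c d "1/4" m "\<lambda>t. \<Prod>k<n. Z k t" "\<lambda>t. inverse (\<Prod>k<n. u k t)"])
    show "curve_and_lines P1 P2 I a b" "curve_and_lines Q1 Q2 I c d"
      using PC QC L L' by (simp_all add: curve_and_lines_def)
    show "(\<lambda>t. \<Prod>k<n. Z k t) holomorphic_on UNIV" using Z by (intro holomorphic_intros) auto
    show "(\<lambda>t. inverse (\<Prod>k<n. u k t)) holomorphic_on UNIV" using u by (intro holomorphic_intros) auto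
    show "inverse (\<Prod>k<n. u k t) \<noteq> 0" for t using u by simp
    show "(\<Prod>i\<in>I. a i * P1 t + b i * P2 t) * (\<Prod>j\<in>I. c j * Q1 t + d j * Q2 t) = inverse (\<Prod>k<n. u k t) * (\<Prod>k<n. Z k t) ^ m" for t
    proof -
      have prodI: "(\<Prod>i\<in>I. g i) = (\<Prod>k<n. \<Prod>i\<in>B k. g i)" for g :: "nat \<Rightarrow> complex"
        unfolding IB by (rule prod.UNION_disjoint) (use B Bdisj in simp_all)
      have "(\<Prod>k<n. Z k t) ^ m = (\<Prod>k<n. u k t * ((\<Prod>i\<in>B k. a i * P1 t + b i * P2 t) * (\<Prod>i\<in>B k. c i * Q1 t + d i * Q2 t)))"
        unfolding prod_power_distrib using eq by (intro prod.cong refl) auto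
      also have "\<dots> = (\<Prod>k<n. u k t) * ((\<Prod>i\<in>I. a i * P1 t + b i * P2 t) * (\<Prod>j\<in>I. c j * Q1 t + d j * Q2 t))"
        unfolding prodI prod.distrib by simp
      finally show ?thesis using u by simp
    qed
  qed (use cI assms(2) in auto)
  moreover have constP: "p t = p 0" if "\<forall>z. wronskian P1 P2 z = 0" for t
    using constant_of_vanishing_wronskian[OF P] that by blast
  moreover have constQ: "q t = q 0" if "\<forall>z. wronskian Q1 Q2 z = 0" for t
    using constant_of_vanishing_wronskian[OF Q] that by blast
  moreover have "\<forall>z. wronskian Q1 Q2 z = 0" if W: "\<forall>z. wronskian P1 P2 z = 0"
  proof
    have "\<exists>c. c \<noteq> 0 \<and> P1 t = c * P1 s \<and> P2 t = c * P2 s" for t s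
      using P(3)[of t] reps_scale[OF P(3)[of s]] constP[OF W, of t] constP[OF W, of s] by (auto simp: vec2_eq_iff)
    then show "wronskian Q1 Q2 z = 0" for z
      by (rule vanishing_wronskian_second_factor[OF assms(1,2) PC QC _ B Bdisj L L' u Z eq]) auto
  qed
  moreover have "\<forall>z. wronskian P1 P2 z = 0" if W: "\<forall>z. wronskian Q1 Q2 z = 0"
  proof
    have "\<exists>c. c \<noteq> 0 \<and> Q1 t = c * Q1 s \<and> Q2 t = c * Q2 s" for t s
      using Q(3)[of t] reps_scale[OF Q(3)[of s]] constQ[OF W, of t] constQ[OF W, of s] by (auto simp: vec2_eq_iff)
    then show "wronskian P1 P2 z = 0" for z
      by (rule vanishing_wronskian_second_factor[OF assms(1,2) QC PC _ B Bdisj L' L u Z])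
         (use eq in \<open>auto simp: mult.commute\<close>)
  qed
  ultimately have base: "fst (f t) = (p 0, q 0)" for t
    by (auto simp: p_def q_def prod_eq_iff)
  have "f t = f 0" for t
    using tower_curve_constant[OF f _ base] assms(2) by simp
  then show "f constant_on UNIV" unfolding constant_on_def by blast
qed

end
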